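(* Let $\mathscr{M}=(X,\mathcal I)$ and $\mathscr{N}=(Y,\mathcal J)$ be matroids, and let $\Phi:\mathscr M\to\mathscr N$ be a morphism of matroids. Let $\omega:X\to\mathbb R_{>0}$ be a positive weight function and let $1\le k<\mathrm{rk}(\mathscr M)$. Suppose $\mathrm B_\omega(k)>0$. Then $$\mathrm B_\omega(k)^2\ =\ \Bigl(1+\frac1k\Bigr)\Bigl(1+\frac{1}{p(k-1)-1}\Bigr)\,\mathrm B_\omega(k-1)\,\mathrm B_\omega(k+1)$$ if and only if there exists a constant $s>0$ such that for every $S\in\mathcal I_{k-1}$ all of the following hold: (1) $|\mathrm{Par}(S)|=p(k-1)$; (2) $\sum_{x\in\mathcal C}\omega(x)=s$ for every $\mathcal C\in\mathrm{Par}(S)$; (3) $g(\Phi(S))=\mathrm{rk}(\mathscr N)$, where $g$ is the rank function of $\mathscr N$.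
   Context: Matroids are finite, given by ground set and independent sets; $\mathcal I_j=\{S\in\mathcal I:|S|=j\}$. The rank functions of $\mathscr M$ and $\mathscr N$ are $f(S)=\max\{|A|:A\subseteq S, A\in\mathcal I\}$ for $S\subseteq X$, and $g$ defined likewise on subsets of $Y$; $\mathrm{rk}(\mathscr M)=f(X)$, $\mathrm{rk}(\mathscr N)=g(Y)$. A morphism $\Phi:\mathscr M\to\mathscr N$ is a function $\Phi:X\to Y$ with $g(\Phi(T))-g(\Phi(S))\le f(T)-f(S)$ for all $S\subseteq T\subseteq X$. A set $S\in\mathcal I$ is a basis of $\Phi$ if $g(\Phi(S))=\mathrm{rk}(\mathscr N)$. Let $\mathcal B_j$ be the set of bases of $\Phi$ of size $j$. Put $\omega(S)=\prod_{x\in S}\omega(x)$ and $\mathrm B_\omega(j)=\sum_{S\in\mathcal B_j}\omega(S)$. For $S\in\mathcal I$, let $\mathrm{Cont}(S)=\{x\in X\setminus S: S\cup\{x\}\in\mathcal I\}$. For $x,y\in\mathrm{Cont}(S)$ write $x\sim_S y$ if $x=y$ or $S\cup\{x,y\}\notin\mathcal I$; this is an equivalence relation, and $\mathrm{Par}(S)$ denotes its set of equivalence classes (parallel classes). Let $p(j)=\max\{|\mathrm{Par}(S)|:S\in\mathcal B_j\}$, with $p(j)=0$ if $\mathcal B_j=\varnothing$. *)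

theory Defs
  imports Complex_Main
begin

locale matroid =
  fixes X :: "'a set" and \<I> :: "'a set set"
  assumes finite_ground: "finite X"
    and indep_subset_ground: "A \<in> \<I> \<Longrightarrow> A \<subseteq> X"
    and indep_empty: "{} \<in> \<I>"
    and indep_mono: "A \<in> \<I> \<Longrightarrow> B \<subseteq> A \<Longrightarrow> B \<in> \<I>"
    and indep_augment: "A \<in> \<I> \<Longrightarrow> B \<in> \<I> \<Longrightarrow> card A < card B \<Longrightarrow> \<exists>x\<in>B - A. insert x A \<in> \<I>"

definition indep_of_size :: "'a set set \<Rightarrow> nat \<Rightarrow> 'a set set" where
  "indep_of_size \<I> j = {S \<in> \<I>. card S = j}"

definition matroid_rank :: "'a set set \<Rightarrow> 'a set \<Rightarrow> nat" where
  "matroid_rank \<I> S = Max {card A | A. A \<subseteq> S \<and> A \<in> \<I>}"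

text \<open>Ranks are natural numbers, so their differences are taken in the integers.\<close>

definition matroid_morphism ::
  "'a set \<Rightarrow> 'a set set \<Rightarrow> 'b set \<Rightarrow> 'b set set \<Rightarrow> ('a \<Rightarrow> 'b) \<Rightarrow> bool" where
  "matroid_morphism X \<I> Y \<J> \<Phi> \<longleftrightarrow>
     matroid X \<I> \<and> matroid Y \<J> \<and> \<Phi> ` X \<subseteq> Y \<and>
     (\<forall>S T. S \<subseteq> T \<and> T \<subseteq> X \<longrightarrow>
        int (matroid_rank \<J> (\<Phi> ` T)) - int (matroid_rank \<J> (\<Phi> ` S)) \<le> int (matroid_rank \<I> T) - int (matroid_rank \<I> S))"

definition morphism_bases ::
  "'a set set \<Rightarrow> 'b set \<Rightarrow> 'b set set \<Rightarrow> ('a \<Rightarrow> 'b) \<Rightarrow> nat \<Rightarrow> 'a set set" where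
  "morphism_bases \<I> Y \<J> \<Phi> j =
     {S \<in> indep_of_size \<I> j. matroid_rank \<J> (\<Phi> ` S) = matroid_rank \<J> Y}"

definition weighted_bases ::
  "'a set set \<Rightarrow> 'b set \<Rightarrow> 'b set set \<Rightarrow> ('a \<Rightarrow> 'b) \<Rightarrow> ('a \<Rightarrow> real) \<Rightarrow> nat \<Rightarrow> real" where
  "weighted_bases \<I> Y \<J> \<Phi> \<omega> j = (\<Sum>S\<in>morphism_bases \<I> Y \<J> \<Phi> j. \<Prod>x\<in>S. \<omega> x)"

definition Cont :: "'a set \<Rightarrow> 'a set set \<Rightarrow> 'a set \<Rightarrow> 'a set" where
  "Cont X \<I> S = {x \<in> X - S. S \<union> {x} \<in> \<I>}"

definition parallel_rel :: "'a set \<Rightarrow> 'a set set \<Rightarrow> 'a set \<Rightarrow> ('a \<times> 'a) set" where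
  "parallel_rel X \<I> S =
     {(x, y). x \<in> Cont X \<I> S \<and> y \<in> Cont X \<I> S \<and> (x = y \<or> S \<union> {x, y} \<notin> \<I>)}"

definition Par :: "'a set \<Rightarrow> 'a set set \<Rightarrow> 'a set \<Rightarrow> 'a set set" where
  "Par X \<I> S = Cont X \<I> S // parallel_rel X \<I> S"

definition max_par ::
  "'a set \<Rightarrow> 'a set set \<Rightarrow> 'b set \<Rightarrow> 'b set set \<Rightarrow> ('a \<Rightarrow> 'b) \<Rightarrow> nat \<Rightarrow> nat" where
  "max_par X \<I> Y \<J> \<Phi> j =
     (if morphism_bases \<I> Y \<J> \<Phi> j = {} then 0
      else Max {card (Par X \<I> S) | S. S \<in> morphism_bases \<I> Y \<J> \<Phi> j})"

end

theory Submission
  imports Defs "HOL-Analysis.Analysis"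
begin

text \<open>
  Encode the bases of \<open>\<Phi>\<close> of size at most \<open>k + 1\<close> in one homogeneous polynomial of degree \<open>k + 1\<close> with a
  homogenising variable \<open>t\<close>, where the terms with \<open>t\<^sup>a\<close> get the extra weight \<open>c\<^sup>a\<^sup>-\<^sup>1\<close> for \<open>a \<ge> 1\<close> and
  \<open>c = 1 + 1 / (p(k - 1) - 1)\<close>. The partial derivatives of order \<open>k - 1\<close> are quadratic forms of
  complete multipartite graphs (with one extra vertex), hence have at most one positive eigenvalue. A trickle-down
  argument transports this to all derivatives in the direction \<open>(\<tau>, \<omega>)\<close>, \<open>\<tau> > 0\<close>: an eigenvector \<open>v\<close> of the
  suitably normalised form for an eigenvalue \<open>\<lambda>\<close> satisfies \<open>\<lambda> \<le> \<lambda>\<^sup>2\<close>, while \<open>\<lambda> \<le> 1\<close> with equality only on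
  the line of the direction, by connectedness. Letting \<open>\<tau> \<rightarrow> 0\<close> gives the inequality \<open>\<ge>\<close>.

  In the case of equality a vector \<open>(1, - \<theta> \<omega>)\<close> lies in the kernel of the top form. It then lies in the kernel of
  the forms of all sets contained in a basis of size \<open>k + 1\<close>, because the top form is a positive combination of
  forms that are nonpositive on this vector. For sets of size \<open>k - 1\<close> the kernel equations say that the parallel classes
  have equal weights and that their number is \<open>p(k - 1)\<close>; a basis exchange then reaches every independent set of
  that size. The converse is a double count.
\<close>

subsection \<open>Quadratic forms with a reverse Cauchy-Schwarz inequality\<close>

definition bform :: "'e set \<Rightarrow> ('e \<Rightarrow> 'e \<Rightarrow> real) \<Rightarrow> ('e \<Rightarrow> real) \<Rightarrow> ('e \<Rightarrow> real) \<Rightarrow> real" where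
  "bform E q u v = (\<Sum>i\<in>E. \<Sum>j\<in>E. q i j * u i * v j)"

text \<open>For symmetric \<open>q\<close> with \<open>q(w, w) > 0\<close> this says that
  \<open>q\<close> is nonpositive on the orthogonal complement of \<open>w\<close>, so it has
  exactly one positive eigenvalue. If \<open>q(w, w) = 0\<close> it holds trivially. Stated as an
  inequality it is a closed condition, which permits a passage to the limit.\<close>

definition rev_CS :: "'e set \<Rightarrow> ('e \<Rightarrow> 'e \<Rightarrow> real) \<Rightarrow> ('e \<Rightarrow> real) \<Rightarrow> bool" where
  "rev_CS E q w \<longleftrightarrow> (\<forall>v. bform E q w w * bform E q v v \<le> (bform E q w v)\<^sup>2)"

lemma bform_combine_left:
  "bform E q (\<lambda>i. a * u i + b * z i) v = a * bform E q u v + b * bform E q z v"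
  unfolding bform_def by (simp add: sum_distrib_left sum.distrib[symmetric] algebra_simps)

lemma bform_combine_right:
  "bform E q u (\<lambda>i. a * v i + b * z i) = a * bform E q u v + b * bform E q u z"
  unfolding bform_def by (simp add: sum_distrib_left sum.distrib[symmetric] algebra_simps)

lemma bform_commute:
  assumes "\<And>i j. i \<in> E \<Longrightarrow> j \<in> E \<Longrightarrow> q i j = q j i"
  shows "bform E q u v = bform E q v u"
  unfolding bform_def by (subst sum.swap, intro sum.cong refl) (simp add: assms)

lemma bform_combine_diag:
  assumes "\<And>i j. i \<in> E \<Longrightarrow> j \<in> E \<Longrightarrow> q i j = q j i"
  shows "bform E q (\<lambda>i. a * u i + b * v i) (\<lambda>i. a * u i + b * v i)
    = a\<^sup>2 * bform E q u u + 2 * a * b * bform E q u v + b\<^sup>2 * bform E q v v"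
  using bform_commute[of E q u v, OF assms]
  by (simp add: bform_combine_left bform_combine_right algebra_simps power2_eq_square)

lemma bform_eq_row_sum: "bform E q u v = (\<Sum>i\<in>E. u i * (\<Sum>j\<in>E. q i j * v j))"
  unfolding bform_def by (simp add: sum_distrib_left algebra_simps)

text \<open>Removing from \<open>v\<close> its component along \<open>w\<close> leaves a vector of
  the orthogonal complement; the value of the form there, expanded, is the claimed
  inequality.\<close>

lemma rev_CS_if_nonpos_orthogonal:
  assumes sym: "\<And>i j. i \<in> E \<Longrightarrow> j \<in> E \<Longrightarrow> q i j = q j i"
    and pos: "bform E q w w > 0"
    and orth: "\<And>z. bform E q w z = 0 \<Longrightarrow> bform E q z z \<le> 0"
  shows "rev_CS E q w"
  unfolding rev_CS_def
proof
  fix v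
  define s where "s = bform E q w v / bform E q w w"
  define z where "z = (\<lambda>i. 1 * v i + (- s) * w i)"
  have "bform E q w z = 0"
    unfolding z_def using pos by (simp only: bform_combine_right) (simp add: s_def)
  then have "bform E q z z \<le> 0"
    by (rule orth)
  also have "bform E q z z = bform E q v v - 2 * s * bform E q w v + s\<^sup>2 * bform E q w w"
    unfolding z_def using bform_combine_diag[of E q 1 v "- s" w, OF sym] bform_commute[of E q v w, OF sym]
    by simp
  also have "\<dots> = bform E q v v - (bform E q w v)\<^sup>2 / bform E q w w"
    using pos by (simp add: s_def power2_eq_square field_simps)
  finally show "bform E q w w * bform E q v v \<le> (bform E q w v)\<^sup>2"
    using pos by (simp add: field_simps)
qed

text \<open>Any hyperplane will do, not only the complement of \<open>w\<close>, so the base cases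
  can choose a convenient functional \<open>l\<close>. If \<open>q(w, w) > 0\<close>, then
  \<open>w\<close> is off the hyperplane and a multiple of it moves \<open>v\<close> into it;
  completing the square bounds the result.\<close>

lemma rev_CS_if_nonpos_hyperplane:
  assumes sym: "\<And>i j. i \<in> E \<Longrightarrow> j \<in> E \<Longrightarrow> q i j = q j i"
    and nonneg: "bform E q w w \<ge> 0"
    and hyper: "\<And>z. (\<Sum>i\<in>E. l i * z i) = 0 \<Longrightarrow> bform E q z z \<le> 0"
  shows "rev_CS E q w"
  unfolding rev_CS_def
proof
  fix v
  let ?L = "\<lambda>z. \<Sum>i\<in>E. l i * z i"
  show "bform E q w w * bform E q v v \<le> (bform E q w v)\<^sup>2"
  proof (cases "bform E q w w = 0")
    case False
    then have Lw: "?L w \<noteq> 0" and pos: "bform E q w w > 0"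
      using nonneg hyper[of w] by auto
    define s where "s = ?L v / ?L w"
    define z where "z = (\<lambda>i. 1 * v i + (- s) * w i)"
    have "?L z = ?L v - s * ?L w"
      unfolding z_def by (simp add: sum_distrib_left sum_subtractf[symmetric] algebra_simps)
    then have "?L z = 0" using Lw by (simp add: s_def)
    then have "bform E q z z \<le> 0" by (rule hyper)
    also have "bform E q z z = bform E q v v - 2 * s * bform E q w v + s\<^sup>2 * bform E q w w"
      unfolding z_def using bform_combine_diag[of E q 1 v "- s" w, OF sym] bform_commute[of E q v w, OF sym]
      by simp
    finally have "bform E q v v \<le> 2 * s * bform E q w v - s\<^sup>2 * bform E q w w" by simp
    then have "bform E q w w * bform E q v v \<le> bform E q w w * (2 * s * bform E q w v - s\<^sup>2 * bform E q w w)"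
      using pos by (intro mult_left_mono) auto
    also have "\<dots> = (bform E q w v)\<^sup>2 - (bform E q w v - s * bform E q w w)\<^sup>2"
      by (simp add: power2_eq_square algebra_simps)
    finally show ?thesis by (smt (verit) zero_le_power2)
  qed simp
qed

text \<open>The first variation at an extremum: for small \<epsilon> of the sign opposite to
  \<open>B\<close> the linear term would dominate.\<close>

lemma linear_term_eq_zero:
  fixes B C :: real
  assumes "\<And>\<epsilon>. 2 * \<epsilon> * B + \<epsilon>\<^sup>2 * C \<ge> 0"
  shows "B = 0"
proof (rule ccontr)
  assume B: "B \<noteq> 0"
  define D where "D = \<bar>C\<bar> + 1"
  have D: "D > 0" "C \<le> D" by (auto simp: D_def)
  have "0 \<le> 2 * (- B / D) * B + (- B / D)\<^sup>2 * C" by (rule assms)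
  also have "\<dots> \<le> 2 * (- B / D) * B + (- B / D)\<^sup>2 * D"
    using D by (intro add_left_mono mult_left_mono) auto
  also have "\<dots> = - B\<^sup>2 / D"
    using D by (simp add: field_simps power2_eq_square)
  finally show False using B D by (simp add: field_simps)
qed

text \<open>The form is nonpositive on the complement of \<open>w\<close>, so a null vector
  \<open>v\<close> in it is a maximizer there. The first variation vanishes along the complement,
  and \<open>v\<close> is orthogonal to \<open>w\<close> as well, hence to everything.\<close>

lemma rev_CS_null_imp_kernel:
  assumes sym: "\<And>i j. i \<in> E \<Longrightarrow> j \<in> E \<Longrightarrow> q i j = q j i"
    and rcs: "rev_CS E q w" and pos: "bform E q w w > 0"
    and orth: "bform E q w v = 0" and null: "bform E q v v = 0"
  shows "bform E q u v = 0"
proof -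
  have neg: "bform E q z z \<le> 0" if "bform E q w z = 0" for z
    using rcs that pos unfolding rev_CS_def
    by (smt (verit, best) mult_pos_pos power_zero_numeral)
  define s where "s = bform E q w u / bform E q w w"
  define z where "z = (\<lambda>i. 1 * u i + (- s) * w i)"
  have wz: "bform E q w z = 0"
    unfolding z_def using pos by (simp only: bform_combine_right) (simp add: s_def)
  have "- bform E q v z = 0"
  proof (rule linear_term_eq_zero)
    fix \<epsilon> :: real
    have "bform E q w (\<lambda>i. 1 * v i + \<epsilon> * z i) = 0"
      by (simp only: bform_combine_right) (simp add: wz orth)
    then have "bform E q (\<lambda>i. 1 * v i + \<epsilon> * z i) (\<lambda>i. 1 * v i + \<epsilon> * z i) \<le> 0"
      by (rule neg)
    then show "0 \<le> 2 * \<epsilon> * (- bform E q v z) + \<epsilon>\<^sup>2 * (- bform E q z z)"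
      using bform_combine_diag[of E q 1 v \<epsilon> z, OF sym] null by simp
  qed
  moreover have "bform E q v z = 1 * bform E q v u + (- s) * bform E q v w"
    unfolding z_def by (simp only: bform_combine_right)
  ultimately show ?thesis
    using orth bform_commute[of E q v w, OF sym] bform_commute[of E q v u, OF sym] by simp
qed

section \<open>The trickle-down step: from the contractions of a tensor to their sum\<close>

lemma continuous_on_bform [continuous_intros]:
  "continuous_on S (\<lambda>v :: 'e \<Rightarrow> real. bform E q v v)"
  unfolding bform_def
  by (intro continuous_intros continuous_on_subset[OF continuous_on_product_coordinates] subset_UNIV)

text \<open>The unit sphere of the \<open>d\<close>-norm, cut by the hyperplane, is compact, so the
  Rayleigh quotient attains its maximum. The vector \<open>z0\<close> only ensures that this set is
  nonempty.\<close>

lemma rayleigh_maximizer: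
  assumes fin: "finite E" and d: "\<And>i. i \<in> E \<Longrightarrow> d i > 0"
    and z0: "(\<Sum>i\<in>E. h i * z0 i) = 0" "(\<Sum>i\<in>E. d i * (z0 i)\<^sup>2) > 0"
  obtains v where "(\<Sum>i\<in>E. d i * (v i)\<^sup>2) = 1" "(\<Sum>i\<in>E. h i * v i) = 0"
    "\<forall>z. (\<Sum>i\<in>E. h i * z i) = 0 \<longrightarrow> bform E q z z \<le> bform E q v v * (\<Sum>i\<in>E. d i * (z i)\<^sup>2)"
proof -
  let ?N = "\<lambda>z :: 'a \<Rightarrow> real. \<Sum>i\<in>E. d i * (z i)\<^sup>2" and ?H = "\<lambda>z. \<Sum>i\<in>E. h i * z i"
  \<comment> \<open>Vectors are functions on the whole type. Pinning the coordinates outside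
    \<open>E\<close> to 0, with the bounds that norm 1 forces inside \<open>E\<close>, gives a
    compact product.\<close>
  define Box where "Box = (\<Pi>\<^sub>E i\<in>(UNIV :: 'a set). if i \<in> E then {- sqrt (1 / d i)..sqrt (1 / d i)} else {0})"
  define K where "K = Box \<inter> {z. ?N z = 1} \<inter> {z. ?H z = 0}"
  have "compactin (product_topology (\<lambda>i. euclidean) UNIV) Box"
    unfolding Box_def by (subst compactin_PiE) auto
  then have "compact Box" by (simp add: euclidean_product_topology)
  moreover have "closed {z. ?N z = 1}" "closed {z. ?H z = 0}"
    by (intro closed_Collect_eq continuous_intros; simp)+
  ultimately have comp: "compact K"
    unfolding K_def by (intro compact_Int_closed)
  have norm: "\<exists>y\<in>K. \<forall>i\<in>E. y i = z i / sqrt (?N z)" if z: "?H z = 0" "?N z > 0" for z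
  proof
    let ?y = "\<lambda>i. if i \<in> E then z i / sqrt (?N z) else 0"
    have "?N ?y = (\<Sum>i\<in>E. (d i * (z i)\<^sup>2) / ?N z)"
      using z by (intro sum.cong refl) (simp add: power_divide)
    also have "\<dots> = 1" using z by (simp add: sum_divide_distrib[symmetric])
    finally have N1: "?N ?y = 1" .
    have "?H ?y = (\<Sum>i\<in>E. (h i * z i) / sqrt (?N z))"
      by (intro sum.cong refl) simp
    also have "\<dots> = 0" using z by (simp add: sum_divide_distrib[symmetric])
    finally have H0: "?H ?y = 0" .
    have "\<bar>?y i\<bar> \<le> sqrt (1 / d i)" if i: "i \<in> E" for i
    proof -
      have "d i * (?y i)\<^sup>2 \<le> 1"
        unfolding N1[symmetric] by (rule member_le_sum) (use i d fin in \<open>auto simp: less_imp_le\<close>)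
      then have "(?y i)\<^sup>2 \<le> 1 / d i" using d[OF i] by (simp add: field_simps)
      then show ?thesis by (rule real_le_rsqrt[of "\<bar>?y i\<bar>", simplified])
    qed
    then have "?y \<in> Box" unfolding Box_def by (fastforce simp: PiE_def abs_le_iff)
    then show "?y \<in> K" unfolding K_def using N1 H0 by blast
  qed auto
  from norm[OF z0] have "K \<noteq> {}" by auto
  then obtain v where v: "v \<in> K" and max: "\<And>y. y \<in> K \<Longrightarrow> bform E q y y \<le> bform E q v v"
    using continuous_attains_sup[OF comp _ continuous_on_bform[of K E q]] by blast
  have "bform E q z z \<le> bform E q v v * ?N z" if z: "?H z = 0" for z
  proof (cases "?N z > 0")
    case True
    obtain y where y: "y \<in> K" "\<forall>i\<in>E. y i = z i / sqrt (?N z)"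
      using norm[OF z True] by blast
    have "bform E q y y = (\<Sum>i\<in>E. \<Sum>j\<in>E. (q i j * z i * z j) / ?N z)"
      unfolding bform_def using y(2) True
      by (intro sum.cong refl) (simp add: real_sqrt_mult_self)
    then have "bform E q y y = bform E q z z / ?N z"
      by (simp add: bform_def sum_divide_distrib[symmetric])
    with max[OF y(1)] True show ?thesis by (simp add: field_simps)
  next
    case False
    then have N0: "?N z = 0"
      using d by (intro antisym sum_nonneg) (auto simp: less_imp_le)
    then have "\<forall>i\<in>E. d i * (z i)\<^sup>2 = 0"
      using d fin by (subst (asm) sum_nonneg_eq_0_iff) (auto simp: less_imp_le)
    then have "\<forall>i\<in>E. z i = 0" using d by fastforce
    then show ?thesis by (simp add: bform_def)
  qed
  with v show ?thesis by (intro that[of v]) (auto simp: K_def)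
qed

text \<open>If the form were positive somewhere on the complement of the constants, the maximal
  Rayleigh quotient with respect to the row sums \<open>h\<close> would be a positive eigenvalue
  \<open>lam\<close>. The contractions give \<open>lam \<ge> 1\<close>, the Dirichlet form gives
  \<open>lam \<le> 1\<close> with equality only for eigenvectors constant along edges, and
  connectedness makes such a vector zero.\<close>

lemma trickle_down_unit:
  fixes q :: "'e \<Rightarrow> 'e \<Rightarrow> real" and Q :: "'e \<Rightarrow> 'e \<Rightarrow> 'e \<Rightarrow> real"
  assumes fin: "finite E"
    and nonneg: "\<And>l i j. l \<in> E \<Longrightarrow> i \<in> E \<Longrightarrow> j \<in> E \<Longrightarrow> Q l i j \<ge> 0"
    and sym1: "\<And>l i j. l \<in> E \<Longrightarrow> i \<in> E \<Longrightarrow> j \<in> E \<Longrightarrow> Q l i j = Q l j i"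
    and sym2: "\<And>l i j. l \<in> E \<Longrightarrow> i \<in> E \<Longrightarrow> j \<in> E \<Longrightarrow> Q l i j = Q i l j"
    and q: "\<And>i j. i \<in> E \<Longrightarrow> j \<in> E \<Longrightarrow> q i j = (\<Sum>l\<in>E. Q l i j)"
    and rcs: "\<And>l. l \<in> E \<Longrightarrow> rev_CS E (Q l) (\<lambda>_. 1)"
    and conn: "\<And>u i j. (\<And>i j. i \<in> E \<Longrightarrow> j \<in> E \<Longrightarrow> q i j > 0 \<Longrightarrow> u i = (u j :: real)) \<Longrightarrow> i \<in> E \<Longrightarrow> j \<in> E \<Longrightarrow>
       (\<Sum>l\<in>E. q i l) > 0 \<Longrightarrow> (\<Sum>l\<in>E. q j l) > 0 \<Longrightarrow> u i = u j"
  shows "rev_CS E q (\<lambda>_. 1)"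
proof -
  define h where "h i = (\<Sum>j\<in>E. q i j)" for i
  \<comment> \<open>Isolated vertices are discarded, so that the weights \<open>h\<close> are
    positive as a norm requires.\<close>
  define S where "S = {i\<in>E. h i > 0}"
  have SE: "S \<subseteq> E" and finS: "finite S" using fin by (auto simp: S_def)
  have q_nonneg: "q i j \<ge> 0" if "i \<in> E" "j \<in> E" for i j
    using that nonneg by (simp add: q sum_nonneg)
  have q_sym: "q i j = q j i" if "i \<in> E" "j \<in> E" for i j
    using that sym1 by (auto simp: q intro!: sum.cong)
  have h_nonneg: "h i \<ge> 0" if "i \<in> E" for i
    using that q_nonneg by (simp add: h_def sum_nonneg)
  have h_zero: "h i = 0" if "i \<in> E - S" for i
    using that h_nonneg[of i] by (auto simp: S_def)
  have q_zero: "q i j = 0" if "i \<in> E - S" "j \<in> E" for i j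
  proof -
    have "h i = 0" using that h_zero by blast
    then show ?thesis
      using that fin q_nonneg unfolding h_def by (subst (asm) sum_nonneg_eq_0_iff) auto
  qed
  have q_zero': "q j i = 0" if "i \<in> E" "i \<notin> S" "j \<in> E" for i j
    using q_zero[of i j] q_sym[of i j] that by simp
  \<comment> \<open>By full symmetry of the tensor it does not matter which slot is summed: the row
    sums of the contraction \<open>Q l\<close> are the entries of row \<open>l\<close> of
    \<open>q\<close>, and its total is \<open>h l\<close>.\<close>
  have row: "(\<Sum>j\<in>E. Q l i j) = q l i" if "l \<in> E" "i \<in> E" for l i
    unfolding q[OF that] using that by (intro sum.cong refl) (simp add: sym1[of l i] sym2[of l _ i])
  have col: "(\<Sum>i\<in>E. Q l i j) = q l j" if "l \<in> E" "j \<in> E" for l j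
    unfolding row[OF that, symmetric] using that by (intro sum.cong refl) (simp add: sym1)
  have Q1: "bform E (Q l) (\<lambda>_. 1) v = (\<Sum>j\<in>E. q l j * v j)" if "l \<in> E" for l v
    unfolding bform_def using that
    by (subst sum.swap) (simp add: sum_distrib_right[symmetric] col)
  have Qh: "bform E (Q l) (\<lambda>_. 1) (\<lambda>_. 1) = h l" if "l \<in> E" for l
    using Q1[OF that] by (simp add: h_def)
  have decomp: "bform E q v v = (\<Sum>l\<in>E. bform E (Q l) v v)" for v
  proof -
    have "bform E q v v = (\<Sum>i\<in>E. \<Sum>j\<in>E. \<Sum>l\<in>E. Q l i j * v i * v j)"
      unfolding bform_def by (intro sum.cong refl) (simp add: q sum_distrib_right)
    also have "\<dots> = (\<Sum>i\<in>E. \<Sum>l\<in>E. \<Sum>j\<in>E. Q l i j * v i * v j)"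
      by (intro sum.cong refl sum.swap)
    also have "\<dots> = (\<Sum>l\<in>E. bform E (Q l) v v)"
      unfolding bform_def by (rule sum.swap)
    finally show ?thesis .
  qed
  have Q_zero: "bform E (Q l) v v = 0" if "l \<in> E - S" for l v
  proof -
    have "Q l i j = 0" if ij: "i \<in> E" "j \<in> E" for i j
    proof -
      have l: "l \<in> E" using \<open>l \<in> E - S\<close> by blast
      have "(\<Sum>j\<in>E. Q l i j) = 0"
        using row[OF l ij(1)] q_zero[OF \<open>l \<in> E - S\<close> ij(1)] by simp
      then show ?thesis
        using l ij fin nonneg by (subst (asm) sum_nonneg_eq_0_iff) auto
    qed
    then show ?thesis by (simp add: bform_def)
  qed
  \<comment> \<open>The sum over \<open>l\<close> of the reverse Cauchy-Schwarz inequalities for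
    \<open>Q l\<close>, each divided by its total \<open>h l\<close>.\<close>
  have upper: "bform E q v v \<le> (\<Sum>l\<in>S. (\<Sum>j\<in>E. q l j * v j)\<^sup>2 / h l)" for v
  proof -
    have "bform E q v v = (\<Sum>l\<in>S. bform E (Q l) v v)"
      unfolding decomp using Q_zero SE fin by (intro sum.mono_neutral_right) auto
    also have "\<dots> \<le> (\<Sum>l\<in>S. (\<Sum>j\<in>E. q l j * v j)\<^sup>2 / h l)"
    proof (rule sum_mono)
      fix l assume l: "l \<in> S"
      then have "h l * bform E (Q l) v v \<le> (\<Sum>j\<in>E. q l j * v j)\<^sup>2"
        using rcs[of l] SE Q1[of l v] Qh[of l] unfolding rev_CS_def by (metis (no_types, lifting) subsetD)
      with l show "bform E (Q l) v v \<le> (\<Sum>j\<in>E. q l j * v j)\<^sup>2 / h l"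
        by (simp add: S_def field_simps)
    qed
    finally show ?thesis .
  qed
  have w1: "bform E q (\<lambda>_. 1) v = (\<Sum>i\<in>S. h i * v i)" for v
  proof -
    have "bform E q (\<lambda>_. 1) v = (\<Sum>j\<in>E. (\<Sum>i\<in>E. q i j) * v j)"
      unfolding bform_def by (subst sum.swap) (simp add: sum_distrib_right)
    also have "\<dots> = (\<Sum>j\<in>E. h j * v j)"
      unfolding h_def by (intro sum.cong refl arg_cong2[of _ _ _ _ "(*)"]) (auto simp: q_sym)
    also have "\<dots> = (\<Sum>i\<in>S. h i * v i)"
      using SE fin h_zero by (intro sum.mono_neutral_right) auto
    finally show ?thesis .
  qed
  have restrict: "bform S q v v = bform E q v v" for v
  proof -
    have "bform E q v v = (\<Sum>i\<in>S. \<Sum>j\<in>E. q i j * v i * v j)"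
      unfolding bform_def using SE fin by (intro sum.mono_neutral_right) (auto simp: q_zero)
    also have "\<dots> = bform S q v v"
      unfolding bform_def using SE fin
      by (intro sum.cong refl sum.mono_neutral_right) (auto simp: q_zero')
    finally show ?thesis by simp
  qed
  have restrict_row: "(\<Sum>j\<in>S. q i j * v j) = (\<Sum>j\<in>E. q i j * v j)" if "i \<in> E" for i v
    using that SE fin q_zero q_sym by (intro sum.mono_neutral_left) (auto simp: q_zero')
  show ?thesis
  proof (cases "bform E q (\<lambda>_. 1) (\<lambda>_. 1) > 0")
    case False
    then have "(\<Sum>i\<in>S. h i) \<le> 0"
      using w1[of "\<lambda>_. 1"] by simp
    moreover have "(\<Sum>i\<in>S. h i) \<ge> 0"
      by (intro sum_nonneg) (simp add: S_def)
    ultimately have "(\<Sum>i\<in>S. h i) = 0" by (rule antisym)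
    then have "\<forall>i\<in>S. h i = 0"
      using finS by (subst (asm) sum_nonneg_eq_0_iff) (auto simp: S_def)
    then have "S = {}" by (auto simp: S_def)
    then show ?thesis using w1[of "\<lambda>_. 1"] by (simp add: rev_CS_def)
  next
    case pos: True
    show ?thesis
    proof (rule rev_CS_if_nonpos_orthogonal[OF q_sym pos])
      fix z0 assume z0: "bform E q (\<lambda>_. 1) z0 = 0"
      show "bform E q z0 z0 \<le> 0"
      proof (rule ccontr)
        assume neg: "\<not> bform E q z0 z0 \<le> 0"
        have N0: "(\<Sum>i\<in>S. h i * (z0 i)\<^sup>2) > 0"
        proof (rule ccontr)
          assume "\<not> ?thesis"
          then have "(\<Sum>i\<in>S. h i * (z0 i)\<^sup>2) = 0"
            by (intro antisym sum_nonneg) (auto simp: S_def)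
          then have "\<forall>i\<in>S. h i * (z0 i)\<^sup>2 = 0"
            using finS by (subst (asm) sum_nonneg_eq_0_iff) (auto simp: S_def)
          then have "\<forall>i\<in>S. z0 i = 0" by (auto simp: S_def)
          then have "bform S q z0 z0 = 0" by (simp add: bform_def)
          with neg show False by (simp add: restrict)
        qed
        have hS: "\<And>i. i \<in> S \<Longrightarrow> h i > 0" by (simp add: S_def)
        show False
        proof (rule rayleigh_maximizer[where q = q, OF finS hS z0[unfolded w1] N0])
          fix v assume v: "(\<Sum>i\<in>S. h i * (v i)\<^sup>2) = 1" "(\<Sum>i\<in>S. h i * v i) = 0"
            and "\<forall>z. (\<Sum>i\<in>S. h i * z i) = 0 \<longrightarrow>
              bform S q z z \<le> bform S q v v * (\<Sum>i\<in>S. h i * (z i)\<^sup>2)"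
          then have max: "bform S q z z \<le> bform S q v v * (\<Sum>i\<in>S. h i * (z i)\<^sup>2)"
            if "(\<Sum>i\<in>S. h i * z i) = 0" for z
            using that by blast
          define lam where "lam = bform E q v v"
          have lam_pos: "lam > 0"
          proof (rule ccontr)
            assume "\<not> lam > 0"
            then have "lam * (\<Sum>i\<in>S. h i * (z0 i)\<^sup>2) \<le> 0"
              using N0 by (simp add: mult_nonpos_nonneg)
            then show False
              using max[of z0] z0 neg by (simp add: w1 restrict lam_def)
          qed
          define D where "D u z = (\<Sum>i\<in>S. h i * u i * z i)" for u z
          \<comment> \<open>The eigenvalue equation, tested so far only against directions inside
            the hyperplane, from the first variation at the maximizer.\<close>
          have eig0: "bform S q v u = lam * D v u" if u: "(\<Sum>i\<in>S. h i * u i) = 0" for u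
          proof -
            have "lam * D v u - bform S q v u = 0"
            proof (rule linear_term_eq_zero)
              fix \<epsilon> :: real
              let ?z = "\<lambda>i. 1 * v i + \<epsilon> * u i"
              have "(\<Sum>i\<in>S. h i * ?z i) = (\<Sum>i\<in>S. h i * v i) + \<epsilon> * (\<Sum>i\<in>S. h i * u i)"
                by (simp add: sum_distrib_left sum.distrib[symmetric] algebra_simps)
              then have "(\<Sum>i\<in>S. h i * ?z i) = 0" using u v(2) by simp
              from max[OF this] have "bform S q ?z ?z \<le> lam * (\<Sum>i\<in>S. h i * (?z i)\<^sup>2)"
                by (simp add: lam_def restrict)
              moreover have "(\<Sum>i\<in>S. h i * (?z i)\<^sup>2)
                  = (\<Sum>i\<in>S. h i * (v i)\<^sup>2) + 2 * \<epsilon> * D v u + \<epsilon>\<^sup>2 * (\<Sum>i\<in>S. h i * (u i)\<^sup>2)"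
                unfolding D_def sum_distrib_left sum.distrib[symmetric]
                by (intro sum.cong refl) (simp add: power2_eq_square algebra_simps)
              moreover have "bform S q ?z ?z = bform S q v v + 2 * \<epsilon> * bform S q v u + \<epsilon>\<^sup>2 * bform S q u u"
                using bform_combine_diag[of S q 1 v \<epsilon> u] q_sym SE by auto
              ultimately show "0 \<le> 2 * \<epsilon> * (lam * D v u - bform S q v u)
                 + \<epsilon>\<^sup>2 * (lam * (\<Sum>i\<in>S. h i * (u i)\<^sup>2) - bform S q u u)"
                using v(1) by (simp add: lam_def restrict algebra_simps)
            qed
            then show ?thesis by simp
          qed
          have one: "bform S q v (\<lambda>_. 1) = 0" "D v (\<lambda>_. 1) = 0"
          proof -
            have "bform S q v (\<lambda>_. 1) = (\<Sum>i\<in>S. v i * (\<Sum>j\<in>S. q i j * 1))"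
              by (rule bform_eq_row_sum)
            also have "\<dots> = (\<Sum>i\<in>S. v i * h i)"
              using SE restrict_row[of _ "\<lambda>_. 1"] unfolding h_def by (intro sum.cong refl) auto
            finally show "bform S q v (\<lambda>_. 1) = 0" using v(2) by (simp add: mult.commute)
            show "D v (\<lambda>_. 1) = 0" using v(2) by (simp add: D_def)
          qed
          \<comment> \<open>Both sides vanish at the constant vector, so subtracting the
            \<open>h\<close>-mean of \<open>u\<close> extends the equation to all
            \<open>u\<close>.\<close>
          have eig: "bform S q v u = lam * D v u" for u
          proof -
            define s where "s = (\<Sum>i\<in>S. h i * u i) / (\<Sum>i\<in>S. h i)"
            have "(\<Sum>i\<in>S. h i) > 0" using pos w1[of "\<lambda>_. 1"] by simp
            moreover have "(\<Sum>i\<in>S. h i * (1 * u i + (- s) * 1)) = (\<Sum>i\<in>S. h i * u i) - s * (\<Sum>i\<in>S. h i)"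
              by (simp add: sum_distrib_left sum_subtractf[symmetric] algebra_simps)
            ultimately have "(\<Sum>i\<in>S. h i * (1 * u i + (- s) * 1)) = 0"
              by (simp add: s_def)
            from eig0[OF this] have "bform S q v (\<lambda>i. 1 * u i + (- s) * 1) = lam * D v (\<lambda>i. 1 * u i + (- s) * 1)" .
            moreover have "bform S q v (\<lambda>i. 1 * u i + (- s) * 1) = bform S q v u"
              unfolding bform_combine_right one(1) by simp
            moreover have "D v (\<lambda>i. 1 * u i + (- s) * 1) = D v u - s * D v (\<lambda>_. 1)"
              by (simp add: D_def sum_distrib_left sum_subtractf[symmetric] algebra_simps)
            ultimately show ?thesis using one(2) by simp
          qed
          have eig_row: "(\<Sum>j\<in>E. q l j * v j) = lam * h l * v l" if l: "l \<in> S" for l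
          proof -
            have "bform S q v (\<lambda>i. if i = l then 1 else 0) = (\<Sum>i\<in>S. q i l * v i)"
              unfolding bform_def using l finS
              by (intro sum.cong refl) (simp add: if_distrib[of "\<lambda>x. _ * x"] sum.delta cong: if_cong)
            also have "\<dots> = (\<Sum>i\<in>E. q l i * v i)"
            proof -
              have "(\<Sum>i\<in>S. q i l * v i) = (\<Sum>i\<in>S. q l i * v i)"
                using l SE q_sym by (intro sum.cong refl) (auto simp: subset_iff)
              then show ?thesis using restrict_row[of l v] l SE by auto
            qed
            finally have "(\<Sum>i\<in>E. q l i * v i) = lam * D v (\<lambda>i. if i = l then 1 else 0)"
              by (simp add: eig)
            also have "D v (\<lambda>i. if i = l then 1 else 0) = h l * v l"
              unfolding D_def using l finS by (simp add: if_distrib[of "\<lambda>x. _ * x"] sum.delta cong: if_cong)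
            finally show ?thesis by simp
          qed
          \<comment> \<open>Inserting the eigenvector into \<open>upper\<close> replaces each row by
            \<open>lam * h l * v l\<close>, which yields
            \<open>lam \<le> lam\<^sup>2\<close>.\<close>
          have "lam \<le> (\<Sum>l\<in>S. (lam * h l * v l)\<^sup>2 / h l)"
            using upper[of v] eig_row by (simp add: lam_def)
          also have "\<dots> = (\<Sum>l\<in>S. lam\<^sup>2 * (h l * (v l)\<^sup>2))"
            
          proof (rule sum.cong)
            fix l assume "l \<in> S"
            then have "h l > 0" by (rule hS)
            then show "(lam * h l * v l)\<^sup>2 / h l = lam\<^sup>2 * (h l * (v l)\<^sup>2)"
              by (simp add: power2_eq_square)
          qed simp
          also have "\<dots> = lam\<^sup>2" using v(1) by (simp add: sum_distrib_left[symmetric])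
          finally have lam1: "lam \<ge> 1" using lam_pos by (simp add: power2_eq_square)
          \<comment> \<open>Each of the two square terms is the normalised weight 1 and the cross
            term is \<open>2 * lam\<close>. With \<open>lam \<ge> 1\<close> the left side, being
            nonnegative, must vanish.\<close>
          have dirichlet: "(\<Sum>i\<in>E. \<Sum>j\<in>E. q i j * (v i - v j)\<^sup>2) = 2 * (1 - lam)"
          proof -
            have h1: "(\<Sum>i\<in>E. \<Sum>j\<in>E. q i j * (v i)\<^sup>2) = 1"
            proof -
              have "(\<Sum>i\<in>E. \<Sum>j\<in>E. q i j * (v i)\<^sup>2) = (\<Sum>i\<in>E. h i * (v i)\<^sup>2)"
                by (simp add: h_def sum_distrib_right)
              also have "\<dots> = (\<Sum>i\<in>S. h i * (v i)\<^sup>2)"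
                using SE fin h_zero by (intro sum.mono_neutral_right) auto
              finally show ?thesis using v(1) by simp
            qed
            have h2: "(\<Sum>i\<in>E. \<Sum>j\<in>E. q i j * (v j)\<^sup>2) = 1"
            proof -
              have "(\<Sum>i\<in>E. \<Sum>j\<in>E. q i j * (v j)\<^sup>2) = (\<Sum>j\<in>E. \<Sum>i\<in>E. q j i * (v j)\<^sup>2)"
                by (subst sum.swap, intro sum.cong refl) (simp add: q_sym)
              then show ?thesis using h1 by simp
            qed
            have "(\<Sum>i\<in>E. \<Sum>j\<in>E. q i j * (v i - v j)\<^sup>2)
              = (\<Sum>i\<in>E. \<Sum>j\<in>E. q i j * (v i)\<^sup>2 + q i j * (v j)\<^sup>2 - 2 * (q i j * v i * v j))"
              by (intro sum.cong refl) (simp add: power2_eq_square algebra_simps)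
            also have "\<dots> = 1 + 1 - 2 * lam"
              unfolding sum.distrib sum_subtractf sum_distrib_left[symmetric] h1 h2
              by (simp add: lam_def bform_def)
            finally show ?thesis by simp
          qed
          have zero: "(\<Sum>i\<in>E. \<Sum>j\<in>E. q i j * (v i - v j)\<^sup>2) = 0"
          proof (rule antisym)
            show "(\<Sum>i\<in>E. \<Sum>j\<in>E. q i j * (v i - v j)\<^sup>2) \<le> 0"
              using dirichlet lam1 by simp
          qed (intro sum_nonneg mult_nonneg_nonneg q_nonneg zero_le_power2)
          have "v i = v j" if "i \<in> E" "j \<in> E" "q i j > 0" for i j
          proof -
            have "(\<Sum>j\<in>E. q i j * (v i - v j)\<^sup>2) = 0"
              using fin zero that(1)
              by (intro sum_nonneg_0[where f = "\<lambda>i. \<Sum>j\<in>E. q i j * (v i - v j)\<^sup>2"]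
                  sum_nonneg mult_nonneg_nonneg q_nonneg zero_le_power2)
            then have "q i j * (v i - v j)\<^sup>2 = 0"
              using fin that(1,2)
              by (intro sum_nonneg_0[where f = "\<lambda>j. q i j * (v i - v j)\<^sup>2"]
                  mult_nonneg_nonneg q_nonneg zero_le_power2)
            with that(3) show ?thesis by simp
          qed
          then have const: "v i = v j" if "i \<in> S" "j \<in> S" for i j
            by (rule conn) (use that SE in \<open>auto simp: S_def h_def\<close>)
          have "S \<noteq> {}" using v(1) by auto
          then obtain i0 where i0: "i0 \<in> S" by blast
          have "(\<Sum>i\<in>S. h i * v i) = v i0 * (\<Sum>i\<in>S. h i)"
            unfolding sum_distrib_left using const[OF _ i0] by (intro sum.cong refl) (simp add: mult.commute)
          moreover have "(\<Sum>i\<in>S. h i) > 0" using pos w1[of "\<lambda>_. 1"] by simp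
          ultimately have "v i0 = 0" using v(2) by simp
          then have "\<forall>i\<in>S. v i = 0" using const[OF _ i0] by simp
          with v(1) show False by simp
        qed
      qed
    qed
  qed
qed

lemma bform_rescale:
  "bform E (\<lambda>i j. a i * b j * q i j) u v = bform E q (\<lambda>i. a i * u i) (\<lambda>i. b i * v i)"
  unfolding bform_def by (intro sum.cong refl) (simp add: algebra_simps)

lemma rev_CS_rescale:
  assumes "\<And>i. i \<in> E \<Longrightarrow> w i \<noteq> 0"
  shows "rev_CS E (\<lambda>i j. w i * w j * q i j) (\<lambda>_. 1) \<longleftrightarrow> rev_CS E q w"
proof -
  have cong: "bform E q u v = bform E q u' v'"
    if "\<And>i. i \<in> E \<Longrightarrow> u i = u' i" "\<And>i. i \<in> E \<Longrightarrow> v i = v' i" for u v u' v'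
    using that by (auto simp: bform_def intro!: sum.cong)
  have "bform E q w v = bform E q w (\<lambda>i. w i * (v i / w i))"
    "bform E q v v = bform E q (\<lambda>i. w i * (v i / w i)) (\<lambda>i. w i * (v i / w i))" for v
    by (rule cong; simp add: assms)+
  note inv = this
  show ?thesis
    unfolding rev_CS_def bform_rescale mult_1_right
  proof (intro iffI allI)
    fix v
    assume "\<forall>v. bform E q w w * bform E q (\<lambda>i. w i * v i) (\<lambda>i. w i * v i) \<le> (bform E q w (\<lambda>i. w i * v i))\<^sup>2"
    then have "bform E q w w * bform E q (\<lambda>i. w i * (v i / w i)) (\<lambda>i. w i * (v i / w i))
        \<le> (bform E q w (\<lambda>i. w i * (v i / w i)))\<^sup>2"
      by (rule spec)
    then show "bform E q w w * bform E q v v \<le> (bform E q w v)\<^sup>2"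
      unfolding inv[symmetric] .
  qed (erule spec)
qed

lemma trickle_down:
  fixes q :: "'e \<Rightarrow> 'e \<Rightarrow> real" and Q :: "'e \<Rightarrow> 'e \<Rightarrow> 'e \<Rightarrow> real"
  assumes fin: "finite E" and w: "\<And>i. i \<in> E \<Longrightarrow> w i > 0"
    and nonneg: "\<And>l i j. l \<in> E \<Longrightarrow> i \<in> E \<Longrightarrow> j \<in> E \<Longrightarrow> Q l i j \<ge> 0"
    and sym1: "\<And>l i j. l \<in> E \<Longrightarrow> i \<in> E \<Longrightarrow> j \<in> E \<Longrightarrow> Q l i j = Q l j i"
    and sym2: "\<And>l i j. l \<in> E \<Longrightarrow> i \<in> E \<Longrightarrow> j \<in> E \<Longrightarrow> Q l i j = Q i l j"
    and q: "\<And>i j. i \<in> E \<Longrightarrow> j \<in> E \<Longrightarrow> q i j = (\<Sum>l\<in>E. w l * Q l i j)"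
    and rcs: "\<And>l. l \<in> E \<Longrightarrow> rev_CS E (Q l) w"
    and conn: "\<And>u i j. (\<And>i j. i \<in> E \<Longrightarrow> j \<in> E \<Longrightarrow> q i j > 0 \<Longrightarrow> u i = (u j :: real)) \<Longrightarrow> i \<in> E \<Longrightarrow> j \<in> E \<Longrightarrow>
       (\<Sum>l\<in>E. w l * q i l) > 0 \<Longrightarrow> (\<Sum>l\<in>E. w l * q j l) > 0 \<Longrightarrow> u i = u j"
  shows "rev_CS E q w"
proof -
  have wnz: "\<And>i. i \<in> E \<Longrightarrow> w i \<noteq> 0" by (drule w) simp
  have "rev_CS E (\<lambda>i j. w i * w j * q i j) (\<lambda>_. 1)"
  \<comment> \<open>The extra factor \<open>w l\<close> keeps the rescaled tensor symmetric in all
    three slots and turns the weighted sum defining \<open>q\<close> into a plain one.\<close>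
  proof (rule trickle_down_unit[where Q = "\<lambda>l i j. w l * (w i * w j * Q l i j)", OF fin])
    fix l assume l: "l \<in> E"
    let ?q = "\<lambda>i j. w i * w j * Q l i j"
    have rcs1: "rev_CS E ?q (\<lambda>_. 1)"
      using rcs[OF l] rev_CS_rescale[of E w "Q l"] wnz by simp
    have scale: "bform E (\<lambda>i j. w l * (w i * w j * Q l i j)) u v = w l * bform E ?q u v" for u v
      by (simp add: bform_def sum_distrib_left algebra_simps)
    show "rev_CS E (\<lambda>i j. w l * (w i * w j * Q l i j)) (\<lambda>_. 1)"
      unfolding rev_CS_def scale
    proof
      fix v
      have "(w l)\<^sup>2 * (bform E ?q (\<lambda>_. 1) (\<lambda>_. 1) * bform E ?q v v)
          \<le> (w l)\<^sup>2 * (bform E ?q (\<lambda>_. 1) v)\<^sup>2"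
        using rcs1 unfolding rev_CS_def by (intro mult_left_mono) auto
      then show "w l * bform E ?q (\<lambda>_. 1) (\<lambda>_. 1) * (w l * bform E ?q v v)
          \<le> (w l * bform E ?q (\<lambda>_. 1) v)\<^sup>2"
        by (simp add: power2_eq_square mult.assoc mult.left_commute)
    qed
  next
    fix u :: "'e \<Rightarrow> real" and i j
    assume u: "\<And>i j. i \<in> E \<Longrightarrow> j \<in> E \<Longrightarrow> 0 < w i * w j * q i j \<Longrightarrow> u i = u j"
      and ij: "i \<in> E" "j \<in> E"
      and "0 < (\<Sum>l\<in>E. w i * w l * q i l)" "0 < (\<Sum>l\<in>E. w j * w l * q j l)"
    then have "0 < w i * (\<Sum>l\<in>E. w l * q i l)" "0 < w j * (\<Sum>l\<in>E. w l * q j l)"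
      by (simp_all add: sum_distrib_left mult.assoc)
    then show "u i = u j"
      using ij by (intro conn[of u i j]) (auto intro!: u simp: w zero_less_mult_iff w[THEN less_not_sym])
  next
    fix i j assume "i \<in> E" "j \<in> E"
    then show "w i * w j * q i j = (\<Sum>l\<in>E. w l * (w i * w j * Q l i j))"
      by (simp add: q sum_distrib_left algebra_simps)
  next
    fix l i j assume E: "l \<in> E" "i \<in> E" "j \<in> E"
    show "0 \<le> w l * (w i * w j * Q l i j)"
      using E w by (intro mult_nonneg_nonneg nonneg) (auto intro: less_imp_le)
    show "w l * (w i * w j * Q l i j) = w l * (w j * w i * Q l j i)"
      using sym1[OF E] by simp
    show "w l * (w i * w j * Q l i j) = w i * (w l * w j * Q i l j)"
      using sym2[OF E] by simp
  qed
  then show ?thesis using rev_CS_rescale[of E w q] wnz by simp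
qed

subsection \<open>Matroids and their quotients\<close>

context matroid
begin

lemma finite_indep: "A \<in> \<I> \<Longrightarrow> finite A"
  using finite_ground indep_subset_ground finite_subset by metis

lemma finite_indep_sets: "finite \<I>"
  by (rule finite_subset[of _ "Pow X"]) (use indep_subset_ground finite_ground in auto)

lemma rank_set_finite: "finite {card A | A. A \<subseteq> S \<and> A \<in> \<I>}"
  by (rule finite_subset[of _ "card ` \<I>"]) (use finite_indep_sets in auto)

lemma card_le_rank: "A \<subseteq> S \<Longrightarrow> A \<in> \<I> \<Longrightarrow> card A \<le> matroid_rank \<I> S"
  unfolding matroid_rank_def by (rule Max_ge[OF rank_set_finite]) blast

lemma rank_witness:
  obtains A where "A \<subseteq> S" "A \<in> \<I>" "card A = matroid_rank \<I> S"
proof -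
  have "matroid_rank \<I> S \<in> {card A | A. A \<subseteq> S \<and> A \<in> \<I>}"
    unfolding matroid_rank_def by (rule Max_in[OF rank_set_finite]) (use indep_empty in blast)
  then show ?thesis using that by auto
qed

lemma rank_mono: "S \<subseteq> T \<Longrightarrow> matroid_rank \<I> S \<le> matroid_rank \<I> T"
  using card_le_rank[of _ T] by (rule_tac rank_witness[of S]) (metis order_trans)

lemma rank_le_card: "finite S \<Longrightarrow> matroid_rank \<I> S \<le> card S"
  by (rule rank_witness[of S]) (metis card_mono)

lemma rank_indep: "A \<in> \<I> \<Longrightarrow> matroid_rank \<I> A = card A"
  by (intro antisym rank_le_card card_le_rank finite_indep subset_refl)

lemma rank_insert_le: "matroid_rank \<I> (insert x S) \<le> Suc (matroid_rank \<I> S)"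
proof -
  obtain A where A: "A \<subseteq> insert x S" "A \<in> \<I>" "card A = matroid_rank \<I> (insert x S)"
    by (rule rank_witness)
  have "card (A - {x}) \<le> matroid_rank \<I> S"
    using A by (intro card_le_rank indep_mono[OF A(2)]) auto
  moreover have "card A \<le> Suc (card (A - {x}))"
    using finite_indep[OF A(2)] card.remove[of A x] by (cases "x \<in> A") simp_all
  ultimately show ?thesis using A(3) by simp
qed

lemma rank_grow:
  assumes "S \<subseteq> T" "matroid_rank \<I> S < matroid_rank \<I> T"
  shows "\<exists>x\<in>T. matroid_rank \<I> S < matroid_rank \<I> (insert x S)"
proof -
  obtain A where A: "A \<subseteq> S" "A \<in> \<I>" "card A = matroid_rank \<I> S" by (rule rank_witness)
  obtain B where B: "B \<subseteq> T" "B \<in> \<I>" "card B = matroid_rank \<I> T" by (rule rank_witness)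
  obtain x where x: "x \<in> B - A" "insert x A \<in> \<I>"
    using indep_augment[OF A(2) B(2)] A(3) B(3) assms(2) by auto
  have "card (insert x A) \<le> matroid_rank \<I> (insert x S)"
    using A(1) x(2) by (intro card_le_rank) auto
  then have "matroid_rank \<I> S < matroid_rank \<I> (insert x S)"
    using x finite_indep[OF A(2)] A(3) by simp
  then show ?thesis using x B(1) by blast
qed

lemma indep_if_card_le_rank:
  assumes "finite S" "card S \<le> matroid_rank \<I> S"
  shows "S \<in> \<I>"
proof -
  obtain A where "A \<subseteq> S" "A \<in> \<I>" "card A = matroid_rank \<I> S" by (rule rank_witness)
  then show ?thesis using assms card_seteq[of S A] by simp
qed

lemma indep_extend:
  assumes "A \<in> \<I>" "A \<subseteq> S" "card A \<le> n" "n \<le> matroid_rank \<I> S"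
  obtains B where "A \<subseteq> B" "B \<subseteq> S" "B \<in> \<I>" "card B = n"
proof -
  have "\<exists>B. A \<subseteq> B \<and> B \<subseteq> S \<and> B \<in> \<I> \<and> card B = n"
    using assms
  proof (induction "n - card A" arbitrary: A)
    case 0
    then show ?case by auto
  next
    case (Suc m)
    obtain C where C: "C \<subseteq> S" "C \<in> \<I>" "card C = matroid_rank \<I> S" by (rule rank_witness)
    have "card A < card C" using C Suc.hyps(2) Suc.prems by simp
    then obtain x where x: "x \<in> C - A" "insert x A \<in> \<I>"
      using indep_augment Suc.prems(1) C(2) by blast
    have card: "card (insert x A) = Suc (card A)"
      using x finite_indep[OF Suc.prems(1)] by simp
    have "\<exists>B. insert x A \<subseteq> B \<and> B \<subseteq> S \<and> B \<in> \<I> \<and> card B = n"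
      using Suc.prems Suc.hyps(2) x C(1) card by (intro Suc.hyps(1)) auto
    then show ?case by blast
  qed
  then show ?thesis using that by blast
qed

lemma Cont_iff: "x \<in> Cont X \<I> S \<longleftrightarrow> x \<notin> S \<and> insert x S \<in> \<I>"
  unfolding Cont_def using indep_subset_ground[of "insert x S"] by auto

lemma finite_Cont: "finite (Cont X \<I> S)"
  unfolding Cont_def using finite_ground by simp

lemma indep_if_mem_Cont: "x \<in> Cont X \<I> S \<Longrightarrow> S \<in> \<I>"
  unfolding Cont_iff using indep_mono[of "insert x S" S] by blast

lemma parallel_rel_iff:
  "(x, y) \<in> parallel_rel X \<I> S \<longleftrightarrow>
     x \<in> Cont X \<I> S \<and> y \<in> Cont X \<I> S \<and> (x = y \<or> insert x (insert y S) \<notin> \<I>)"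
  unfolding parallel_rel_def by (simp add: insert_commute)

text \<open>Augmenting \<open>S\<close> with \<open>y\<close> from \<open>S\<close> with
  \<open>x\<close> and \<open>z\<close> adds \<open>x\<close> or \<open>z\<close>. Read
  contrapositively, this is transitivity of parallelism.\<close>

lemma parallel_trans:
  assumes "y \<in> Cont X \<I> S" "x \<noteq> z" "insert x (insert z S) \<in> \<I>" "x \<in> Cont X \<I> S" "z \<in> Cont X \<I> S"
  shows "(x \<noteq> y \<and> insert x (insert y S) \<in> \<I>) \<or> (y \<noteq> z \<and> insert y (insert z S) \<in> \<I>)"
proof -
  have S: "finite S" using assms(1) finite_indep indep_if_mem_Cont by blast
  have "card (insert y S) < card (insert x (insert z S))"
    using assms S by (simp add: Cont_iff)
  then obtain t where "t \<in> insert x (insert z S) - insert y S" "insert t (insert y S) \<in> \<I>"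
    using indep_augment[of "insert y S" "insert x (insert z S)"] assms(1,3) by (auto simp: Cont_iff)
  then show ?thesis using assms(1) by (auto simp: insert_commute)
qed

lemma equiv_parallel_rel: "equiv (Cont X \<I> S) (parallel_rel X \<I> S)"
proof (intro equivI refl_onI symI transI)
  fix x y z assume "(x, y) \<in> parallel_rel X \<I> S" "(y, z) \<in> parallel_rel X \<I> S"
  then show "(x, z) \<in> parallel_rel X \<I> S"
    using parallel_trans[of y S x z] unfolding parallel_rel_iff by metis
qed (auto simp: parallel_rel_def insert_commute)

lemma finite_Par: "finite (Par X \<I> S)"
  unfolding Par_def by (rule finite_quotient[OF finite_Cont]) (auto simp: parallel_rel_def)

text \<open>The two elements completing \<open>S\<close> to an independent set of size
  \<open>card S + 2\<close> are not parallel. This keeps the denominator \<open>p - 1\<close>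
  positive later.\<close>

lemma card_Par_ge_2:
  assumes S: "S \<in> \<I>" and card: "card S + 2 \<le> matroid_rank \<I> X"
  shows "card (Par X \<I> S) \<ge> 2"
proof -
  obtain B where B: "S \<subseteq> B" "B \<in> \<I>" "card B = card S + 2"
    by (rule indep_extend[OF S indep_subset_ground[OF S] le_add1 card])
  have "card (B - S) = 2"
    using B by (simp add: card_Diff_subset finite_indep[OF S])
  then obtain x y where xy: "B - S = {x, y}" "x \<noteq> y" by (auto simp: card_2_iff)
  have ins: "insert x (insert y S) \<in> \<I>" using indep_mono[OF B(2), of "insert x (insert y S)"] B(1) xy by auto
  then have "insert x S \<in> \<I>" "insert y S \<in> \<I>" by (blast intro: indep_mono)+
  then have C: "x \<in> Cont X \<I> S" "y \<in> Cont X \<I> S" using xy by (auto simp: Cont_iff)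
  let ?r = "parallel_rel X \<I> S"
  have "?r `` {x} \<noteq> ?r `` {y}"
    using eq_equiv_class_iff[OF equiv_parallel_rel C] xy(2) ins by (simp add: parallel_rel_iff)
  moreover have "{?r `` {x}, ?r `` {y}} \<subseteq> Par X \<I> S"
    using C by (auto simp: Par_def quotient_def)
  ultimately show ?thesis
    using card_mono[OF finite_Par, of "{?r `` {x}, ?r `` {y}}" S] by simp
qed

text \<open>Extend \<open>S \<inter> S'\<close> together with \<open>x\<close> inside
  \<open>insert x S\<close> to the size of \<open>S\<close>. Exactly one element is left out, and it
  lies outside \<open>S'\<close>.\<close>

lemma indep_exchange:
  assumes S: "S \<in> \<I>" and S': "S' \<in> \<I>" and x: "x \<in> S' - S" and dep: "insert x S \<notin> \<I>"
  obtains y where "y \<in> S - S'" "insert x (S - {y}) \<in> \<I>"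
proof -
  have fin: "finite S" using S by (rule finite_indep)
  have "insert x (S \<inter> S') \<in> \<I>" using x by (intro indep_mono[OF S']) auto
  moreover have "card (insert x (S \<inter> S')) \<le> card S"
  proof -
    have "S \<inter> S' \<noteq> S"
    proof
      assume "S \<inter> S' = S"
      then have "insert x S \<subseteq> S'" using x by blast
      with dep S' indep_mono show False by blast
    qed
    then have "card (S \<inter> S') < card S" using fin by (intro psubset_card_mono) auto
    then show ?thesis using fin x by simp
  qed
  moreover have "card S \<le> matroid_rank \<I> (insert x S)"
    using S by (intro card_le_rank) auto
  ultimately obtain B where B: "insert x (S \<inter> S') \<subseteq> B" "B \<subseteq> insert x S" "B \<in> \<I>" "card B = card S"
    using indep_extend[of "insert x (S \<inter> S')" "insert x S" "card S"] by blast
  have "B \<noteq> insert x S" using B(3) dep by blast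
  then obtain y where y: "y \<in> insert x S - B" using B(2) by blast
  have sub: "B \<subseteq> insert x (S - {y})" using B(2) y by blast
  have "card (insert x (S - {y})) = card B"
    using y B(1,4) fin x card.remove[OF fin, of y] by auto
  then have "B = insert x (S - {y})"
    using sub fin by (intro card_subset_eq) auto
  then show ?thesis using that[of y] y B(1,3) by auto
qed

end

text \<open>Here \<gamma> abstracts the pullback of the target rank along the morphism, so that
  \<open>Y\<close> and \<open>\<J>\<close> disappear; \<open>R\<close> is the rank of the target.
  The growth axiom is the single-element form of the rank axioms of the target.\<close>

locale matroid_quotient = matroid X \<I> for X :: "'a set" and \<I> +
  fixes \<gamma> :: "'a set \<Rightarrow> nat" and R :: nat
  assumes quot_mono: "S \<subseteq> T \<Longrightarrow> T \<subseteq> X \<Longrightarrow> \<gamma> S \<le> \<gamma> T"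
    and quot_rank: "S \<subseteq> T \<Longrightarrow> T \<subseteq> X \<Longrightarrow> \<gamma> T + matroid_rank \<I> S \<le> \<gamma> S + matroid_rank \<I> T"
    and quot_grow: "S \<subseteq> T \<Longrightarrow> T \<subseteq> X \<Longrightarrow> \<gamma> S < \<gamma> T \<Longrightarrow> \<exists>x\<in>T. \<gamma> S < \<gamma> (insert x S)"
    and quot_top: "\<gamma> X = R"
begin

lemma quot_le_top: "S \<subseteq> X \<Longrightarrow> \<gamma> S \<le> R"
  using quot_mono[of S X] quot_top by simp

lemma quot_insert_le: "insert x S \<subseteq> X \<Longrightarrow> \<gamma> (insert x S) \<le> Suc (\<gamma> S)"
  using quot_rank[OF subset_insertI, of x S] rank_insert_le[of x S] by simp

lemma quot_insert_ge: "insert x S \<subseteq> X \<Longrightarrow> \<gamma> S \<le> \<gamma> (insert x S)"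
  by (rule quot_mono) auto

text \<open>A rise of \<gamma> forces a rise of the matroid rank, so the new element preserves
  independence.\<close>

lemma indep_insert_if_quot_less:
  assumes "S \<in> \<I>" "x \<in> X" "\<gamma> S < \<gamma> (insert x S)"
  shows "x \<notin> S" "insert x S \<in> \<I>" "\<gamma> (insert x S) = Suc (\<gamma> S)"
proof -
  have sub: "insert x S \<subseteq> X" using assms indep_subset_ground by blast
  show nin: "x \<notin> S" using assms(3) by (auto simp: insert_absorb)
  show "\<gamma> (insert x S) = Suc (\<gamma> S)" using quot_insert_le[OF sub] assms(3) by simp
  have "matroid_rank \<I> S < matroid_rank \<I> (insert x S)"
    using quot_rank[OF subset_insertI sub] assms(3) by simp
  then show "insert x S \<in> \<I>"
    using rank_indep[OF assms(1)] finite_indep[OF assms(1)] nin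
    by (intro indep_if_card_le_rank) auto
qed

text \<open>Diminishing returns. If \<open>x\<close> adds nothing to \<open>S\<close>, then unit
  increments show that \<open>y\<close> adds nothing either, and by \<open>quot_grow\<close> the two
  cannot add anything jointly.\<close>

lemma quot_diminishing:
  assumes sub: "insert x (insert y S) \<subseteq> X"
    and less: "\<gamma> (insert y S) < \<gamma> (insert x (insert y S))"
  shows "\<gamma> S < \<gamma> (insert x S)"
proof (rule ccontr)
  assume "\<not> ?thesis"
  moreover have "\<gamma> S \<le> \<gamma> (insert x S)" using sub by (intro quot_insert_ge) auto
  ultimately have x: "\<gamma> (insert x S) = \<gamma> S" by simp
  have "\<gamma> (insert y (insert x S)) \<le> Suc (\<gamma> (insert x S))"
    using sub by (intro quot_insert_le) auto
  then have "\<gamma> (insert y S) \<le> \<gamma> S" using x less by (simp add: insert_commute)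
  moreover have "\<gamma> S \<le> \<gamma> (insert y S)" using sub by (intro quot_insert_ge) auto
  ultimately have y: "\<gamma> (insert y S) = \<gamma> S" by simp
  have "\<exists>z\<in>insert x (insert y S). \<gamma> S < \<gamma> (insert z S)"
    using sub less y by (intro quot_grow) auto
  then show False using x y by (auto simp: insert_absorb)
qed

text \<open>As \<open>insert x S\<close> is dependent, removing \<open>y\<close> does not lower its
  rank, and therefore does not lower \<gamma>.\<close>

lemma quot_exchange:
  assumes S: "S \<in> \<I>" and dep: "insert x S \<notin> \<I>" and x: "x \<in> X" and y: "y \<in> S"
    and ind: "insert x (S - {y}) \<in> \<I>"
  shows "\<gamma> S \<le> \<gamma> (insert x (S - {y}))"
proof -
  have fin: "finite S" using S by (rule finite_indep)
  have nin: "x \<notin> S" using S dep by (auto simp: insert_absorb)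
  have sub: "insert x S \<subseteq> X" using x indep_subset_ground[OF S] by blast
  have "card (insert x (S - {y})) = card S"
    using fin nin card.remove[OF fin y] by simp
  moreover have "matroid_rank \<I> (insert x S) < card (insert x S)"
    using dep fin indep_if_card_le_rank[of "insert x S"] by (meson finite_insert not_le)
  ultimately have "matroid_rank \<I> (insert x S) \<le> matroid_rank \<I> (insert x (S - {y}))"
    using rank_indep[OF ind] fin nin by simp
  then have "\<gamma> (insert x S) \<le> \<gamma> (insert x (S - {y}))"
    using quot_rank[OF insert_mono[OF Diff_subset] sub, of "{y}"] by simp
  moreover have "\<gamma> S \<le> \<gamma> (insert x S)" using sub by (rule quot_insert_ge)
  ultimately show ?thesis by simp
qed

lemma quot_step:
  assumes "S \<subseteq> X" "\<gamma> S < R"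
  obtains x where "x \<in> X" "\<gamma> S < \<gamma> (insert x S)"
  using quot_grow[of S X] quot_top assms by auto

end

lemma matroid_quotient_morphism:
  assumes "matroid_morphism X \<I> Y \<J> \<Phi>" and top: "matroid_rank \<J> (\<Phi> ` X) = matroid_rank \<J> Y"
  shows "matroid_quotient X \<I> (\<lambda>S. matroid_rank \<J> (\<Phi> ` S)) (matroid_rank \<J> Y)"
proof -
  interpret M: matroid X \<I> using assms by (simp add: matroid_morphism_def)
  interpret N: matroid Y \<J> using assms by (simp add: matroid_morphism_def)
  show ?thesis
  proof
    fix S T assume ST: "S \<subseteq> T" "T \<subseteq> X"
    show "matroid_rank \<J> (\<Phi> ` S) \<le> matroid_rank \<J> (\<Phi> ` T)"
      using ST by (intro N.rank_mono image_mono)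
    show "matroid_rank \<J> (\<Phi> ` T) + matroid_rank \<I> S \<le> matroid_rank \<J> (\<Phi> ` S) + matroid_rank \<I> T"
    proof -
      have "int (matroid_rank \<J> (\<Phi> ` T)) - int (matroid_rank \<J> (\<Phi> ` S))
          \<le> int (matroid_rank \<I> T) - int (matroid_rank \<I> S)"
        using assms(1) ST by (simp add: matroid_morphism_def)
      then show ?thesis by linarith
    qed
    show "\<exists>x\<in>T. matroid_rank \<J> (\<Phi> ` S) < matroid_rank \<J> (\<Phi> ` insert x S)"
      if "matroid_rank \<J> (\<Phi> ` S) < matroid_rank \<J> (\<Phi> ` T)"
      using N.rank_grow[OF image_mono[OF ST(1)] that] by auto
  qed (rule top)
qed

subsection \<open>Directional derivatives of symmetric tensors\<close>

locale commuting_steps =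
  fixes st :: "'e \<Rightarrow> 's \<Rightarrow> 's"
  assumes comm: "st i (st j s) = st j (st i s)"
begin

text \<open>Read \<open>F\<close> as a symmetric tensor, \<open>st\<close> as adding one index: then \<open>dder E w F n\<close> is the contraction of
  \<open>n\<close> slots with \<open>w\<close>, that is, an \<open>n\<close>-fold directional derivative of a homogeneous polynomial.\<close>

fun dder :: "'e set \<Rightarrow> ('e \<Rightarrow> real) \<Rightarrow> ('s \<Rightarrow> real) \<Rightarrow> nat \<Rightarrow> 's \<Rightarrow> real" where
  "dder E w F 0 s = F s"
| "dder E w F (Suc n) s = (\<Sum>i\<in>E. w i * dder E w F n (st i s))"

lemma dder_nonneg:
  assumes "\<And>i. i \<in> E \<Longrightarrow> w i \<ge> 0" "\<And>s. F s \<ge> 0"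
  shows "dder E w F n s \<ge> 0"
  by (induction n arbitrary: s) (auto intro!: sum_nonneg mult_nonneg_nonneg assms)

lemma bform_dder:
  "bform E (\<lambda>i j. dder E w F n (st i (st j s))) w v = (\<Sum>j\<in>E. v j * dder E w F (Suc n) (st j s))"
  unfolding bform_def by (subst sum.swap) (simp add: sum_distrib_left algebra_simps)

lemma bform_dder_diag:
  "bform E (\<lambda>i j. dder E w F n (st i (st j s))) w w = dder E w F (Suc (Suc n)) s"
  unfolding bform_dder by simp

lemma bform_dder_Suc:
  "bform E (\<lambda>i j. dder E w F (Suc n) (st i (st j s))) u v
    = (\<Sum>l\<in>E. w l * bform E (\<lambda>i j. dder E w F n (st i (st j (st l s)))) u v)"
proof -
  have move: "st l (st i (st j s)) = st i (st j (st l s))" for i j l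
    by (metis comm)
  have "bform E (\<lambda>i j. dder E w F (Suc n) (st i (st j s))) u v
      = (\<Sum>i\<in>E. \<Sum>j\<in>E. \<Sum>l\<in>E. w l * (dder E w F n (st i (st j (st l s))) * u i * v j))"
    unfolding bform_def by (simp add: move sum_distrib_right mult.assoc)
  also have "\<dots> = (\<Sum>i\<in>E. \<Sum>l\<in>E. \<Sum>j\<in>E. w l * (dder E w F n (st i (st j (st l s))) * u i * v j))"
    by (intro sum.cong refl sum.swap)
  also have "\<dots> = (\<Sum>l\<in>E. \<Sum>i\<in>E. \<Sum>j\<in>E. w l * (dder E w F n (st i (st j (st l s))) * u i * v j))"
    by (rule sum.swap)
  finally show ?thesis unfolding bform_def by (simp add: sum_distrib_left)
qed

text \<open>Induction on the order: the form of order \<open>Suc n\<close> at \<open>s\<close> is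
  the \<open>w\<close>-weighted sum of the forms of order \<open>n\<close> at the neighbouring
  states. The predicate \<open>P\<close> carries an invariant such as the degree. Connectedness
  concerns the support graph of the form and is required from order 1 on.\<close>

lemma rev_CS_dder:
  fixes w :: "'e \<Rightarrow> real" and F :: "'s \<Rightarrow> real"
  assumes fin: "finite E" and w: "\<And>i. i \<in> E \<Longrightarrow> w i > 0" and F: "\<And>s. F s \<ge> 0"
    and base: "\<And>s. P 0 s \<Longrightarrow> rev_CS E (\<lambda>i j. F (st i (st j s))) w"
    and step: "\<And>n s i. P (Suc n) s \<Longrightarrow> i \<in> E \<Longrightarrow> P n (st i s)"
    and conn: "\<And>n s u i j. P (Suc n) s \<Longrightarrow>
      (\<And>i j. i \<in> E \<Longrightarrow> j \<in> E \<Longrightarrow> dder E w F (Suc n) (st i (st j s)) > 0 \<Longrightarrow> u i = (u j :: real)) \<Longrightarrow>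
      i \<in> E \<Longrightarrow> j \<in> E \<Longrightarrow> dder E w F (Suc (Suc n)) (st i s) > 0 \<Longrightarrow>
      dder E w F (Suc (Suc n)) (st j s) > 0 \<Longrightarrow> u i = u j"
  shows "P n s \<Longrightarrow> rev_CS E (\<lambda>i j. dder E w F n (st i (st j s))) w"
proof (induction n arbitrary: s)
  case 0
  then show ?case by (simp add: base)
next
  case (Suc n)
  have w0: "w i \<ge> 0" if "i \<in> E" for i using w[OF that] by simp
  have row: "(\<Sum>l\<in>E. w l * dder E w F (Suc n) (st i (st l s))) = dder E w F (Suc (Suc n)) (st i s)" for i
    unfolding dder.simps(2)[of E w F "Suc n"] using comm by metis
  show ?case
  proof (rule trickle_down[where Q = "\<lambda>l i j. dder E w F n (st i (st j (st l s)))", OF fin w])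
    fix l assume "l \<in> E"
    then show "rev_CS E (\<lambda>i j. dder E w F n (st i (st j (st l s)))) w"
      by (intro Suc.IH step[OF Suc.prems])
  next
    fix l i j
    show "0 \<le> dder E w F n (st i (st j (st l s)))"
      by (rule dder_nonneg[OF w0 F])
    show "dder E w F n (st i (st j (st l s))) = dder E w F n (st j (st i (st l s)))"
      by (subst comm) (rule refl)
    show "dder E w F n (st i (st j (st l s))) = dder E w F n (st l (st j (st i s)))"
      by (metis comm)
  next
    fix i j
    show "dder E w F (Suc n) (st i (st j s)) = (\<Sum>l\<in>E. w l * dder E w F n (st i (st j (st l s))))"
      by (simp, intro sum.cong refl) (metis comm)
  next
    fix u :: "'e \<Rightarrow> real" and i j
    assume u: "\<And>i j. i \<in> E \<Longrightarrow> j \<in> E \<Longrightarrow> 0 < dder E w F (Suc n) (st i (st j s)) \<Longrightarrow> u i = u j"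
      and "i \<in> E" "j \<in> E"
      and "0 < (\<Sum>l\<in>E. w l * dder E w F (Suc n) (st i (st l s)))"
        "0 < (\<Sum>l\<in>E. w l * dder E w F (Suc n) (st j (st l s)))"
    then show "u i = u j"
      unfolding row by (intro conn[OF Suc.prems, of u i j]) 
  qed
qed

end

section \<open>Quadratic forms of complete multipartite graphs\<close>

lemma sum_quotient:
  assumes "finite K" "equiv K r"
  shows "(\<Sum>C\<in>K // r. \<Sum>x\<in>C. f x) = (\<Sum>x\<in>K. f x)"
proof -
  have "(\<Sum>C\<in>K // r. \<Sum>x\<in>C. f x) = sum f (\<Union> (K // r))"
  proof (rule sum.Union_disjoint[symmetric, unfolded comp_def])
    show "\<forall>A\<in>K // r. finite A"
      using assms finite_subset in_quotient_imp_subset by metis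
    show "\<forall>A\<in>K // r. \<forall>B\<in>K // r. A \<noteq> B \<longrightarrow> A \<inter> B = {}"
      using quotient_disj[OF assms(2)] by blast
  qed
  then show ?thesis by (simp add: Union_quotient[OF assms(2)])
qed

lemma sum_equiv_pairs:
  fixes y :: "'e \<Rightarrow> real"
  assumes fin: "finite K" and eq: "equiv K r"
  shows "(\<Sum>i\<in>K. \<Sum>j\<in>K. if (i, j) \<in> r then y i * y j else 0) = (\<Sum>C\<in>K // r. (\<Sum>i\<in>C. y i)\<^sup>2)"
proof -
  have "(\<Sum>j\<in>K. if (i, j) \<in> r then y i * y j else 0) = y i * (\<Sum>j\<in>C. y j)"
    if C: "C \<in> K // r" "i \<in> C" for C i
  proof -
    have "C = r `` {i}"
      using C eq by (metis Image_singleton_iff equiv_class_eq quotientE)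
    moreover have "r `` {i} \<subseteq> K" using eq by (auto simp: equiv_def refl_on_def)
    ultimately have "C \<subseteq> K" "\<And>j. j \<in> C \<longleftrightarrow> (i, j) \<in> r" by auto
    then show ?thesis
      unfolding sum_distrib_left using fin by (intro sum.mono_neutral_cong_right) auto
  qed
  then have "(\<Sum>C\<in>K // r. \<Sum>i\<in>C. \<Sum>j\<in>K. if (i, j) \<in> r then y i * y j else 0)
      = (\<Sum>C\<in>K // r. \<Sum>i\<in>C. y i * (\<Sum>j\<in>C. y j))"
    by (intro sum.cong refl)
  then show ?thesis
    by (simp only: sum_quotient[OF fin eq]) (simp add: power2_eq_square sum_distrib_right)
qed

text \<open>By \<open>cotrans\<close>, non-adjacency is an equivalence on the non-isolated vertices
  \<open>K\<close>. With \<open>y i = \<sigma> i * z i\<close> the form is \<kappa> times the square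
  of the total of \<open>y\<close> minus the sum of the squared class totals, and the hyperplane
  kills the first term.\<close>

lemma bform_multipartite_nonpos:
  fixes z :: "'e \<Rightarrow> real"
  assumes fin: "finite E" and \<kappa>: "\<kappa> \<ge> 0"
    and q: "\<And>i j. i \<in> E \<Longrightarrow> j \<in> E \<Longrightarrow> q i j = \<kappa> * (\<sigma> i * \<sigma> j * (if adj i j then 1 else 0))"
    and K: "K = {i \<in> E. \<exists>j\<in>E. adj i j}"
    and irrefl: "\<And>i. i \<in> E \<Longrightarrow> \<not> adj i i"
    and sym: "\<And>i j. adj i j \<Longrightarrow> adj j i"
    and cotrans: "\<And>i j l. i \<in> E \<Longrightarrow> l \<in> E \<Longrightarrow> j \<in> K \<Longrightarrow> adj i l \<Longrightarrow> adj i j \<or> adj j l"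
    and zero: "(\<Sum>i\<in>E. (if i \<in> K then \<sigma> i else 0) * z i) = 0"
  shows "bform E q z z \<le> 0"
proof -
  define y where "y i = \<sigma> i * z i" for i
  define r where "r = {(i, j). i \<in> K \<and> j \<in> K \<and> \<not> adj i j}"
  have KE: "K \<subseteq> E" and finK: "finite K" using K fin by auto
  have eq: "equiv K r"
  proof (intro equivI refl_onI symI transI)
    fix i j l assume "(i, j) \<in> r" "(j, l) \<in> r"
    then show "(i, l) \<in> r" using cotrans[of i l j] KE unfolding r_def by blast
  qed (use irrefl sym KE in \<open>auto simp: r_def\<close>)
  have y0: "(\<Sum>i\<in>K. y i) = 0"
  proof -
    have "(\<Sum>i\<in>K. y i) = (\<Sum>i\<in>E. (if i \<in> K then \<sigma> i else 0) * z i)"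
      unfolding y_def using KE fin by (intro sum.mono_neutral_cong_left) auto
    then show ?thesis using zero by simp
  qed
  have "bform E q z z = (\<Sum>i\<in>E. \<Sum>j\<in>E. \<kappa> * (if adj i j then y i * y j else 0))"
    unfolding bform_def by (intro sum.cong refl) (simp add: q y_def)
  also have "\<dots> = (\<Sum>i\<in>K. \<Sum>j\<in>E. \<kappa> * (if adj i j then y i * y j else 0))"
    using KE fin by (intro sum.mono_neutral_right) (auto simp: K)
  also have "\<dots> = (\<Sum>i\<in>K. \<Sum>j\<in>K. \<kappa> * (if adj i j then y i * y j else 0))"
    using KE fin sym by (intro sum.cong refl sum.mono_neutral_right) (auto simp: K)
  also have "\<dots> = (\<Sum>i\<in>K. \<Sum>j\<in>K. \<kappa> * (y i * y j) - \<kappa> * (if (i, j) \<in> r then y i * y j else 0))"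
    by (intro sum.cong refl) (auto simp: r_def)
  also have "\<dots> = \<kappa> * ((\<Sum>i\<in>K. y i) * (\<Sum>j\<in>K. y j)) - \<kappa> * (\<Sum>C\<in>K // r. (\<Sum>i\<in>C. y i)\<^sup>2)"
    unfolding sum_subtractf sum_equiv_pairs[OF finK eq, symmetric]
    by (subst sum_product) (simp only: sum_distrib_left)
  also have "\<dots> \<le> 0" using \<kappa> y0 by (simp add: sum_nonneg)
  finally show ?thesis .
qed

subsection \<open>The generating tensor of a matroid quotient\<close>

text \<open>A state \<open>(a, S, b)\<close> stands for \<open>a\<close> derivatives in the homogenising variable \<open>None\<close> and one in each
  variable of \<open>S\<close>; \<open>b\<close> records that no variable was used twice.\<close>

fun tstep :: "'a option \<Rightarrow> nat \<times> 'a set \<times> bool \<Rightarrow> nat \<times> 'a set \<times> bool" where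
  "tstep None (a, S, b) = (Suc a, S, b)"
| "tstep (Some x) (a, S, b) = (a, insert x S, b \<and> x \<notin> S)"

lemma tstep_commute: "tstep i (tstep j s) = tstep j (tstep i s)"
  by (cases s; cases i; cases j) auto

interpretation T: commuting_steps tstep
  by standard (rule tstep_commute)

locale weighted_quotient = matroid_quotient X \<I> \<gamma> R
  for X :: "'a set" and \<I> and \<gamma> and R +
  fixes \<omega> :: "'a \<Rightarrow> real" and c :: real
  assumes omega_pos: "x \<in> X \<Longrightarrow> \<omega> x > 0" and c_pos: "c > 0"
begin

definition dirs :: "'a option set" where "dirs = insert None (Some ` X)"

definition wt :: "real \<Rightarrow> 'a option \<Rightarrow> real" where "wt \<tau> = case_option \<tau> \<omega>"

text \<open>The truncated exponent is intended: the weights for \<open>a = 0, 1, 2, 3\<close> are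
  \<open>1, 1, c, c\<^sup>2\<close>. So at \<open>a = 0\<close> the factor \<open>c\<close> enters
  the quadratic form only in the entry \<open>None\<close>, \<open>None\<close>, while for
  \<open>a \<ge> 1\<close> it amounts to a rescaling of the direction \<open>None\<close>.\<close>

definition tens :: "nat \<times> 'a set \<times> bool \<Rightarrow> real" where
  "tens = (\<lambda>(a, S, b). if b \<and> S \<in> \<I> \<and> \<gamma> S = R then c ^ (a - 1) else 0)"

abbreviation D :: "real \<Rightarrow> nat \<Rightarrow> nat \<times> 'a set \<times> bool \<Rightarrow> real" where
  "D \<tau> \<equiv> T.dder dirs (wt \<tau>) tens"

lemma finite_dirs: "finite dirs"
  unfolding dirs_def using finite_ground by simp

lemma sum_dirs: "(\<Sum>i\<in>dirs. f i) = f None + (\<Sum>x\<in>X. f (Some x))"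
  unfolding dirs_def using finite_ground by (simp add: sum.reindex image_iff)

lemma None_dirs [simp]: "None \<in> dirs" and Some_dirs [simp]: "Some x \<in> dirs \<longleftrightarrow> x \<in> X"
  unfolding dirs_def by auto

lemma bex_dirs: "(\<exists>i\<in>dirs. P i) \<longleftrightarrow> P None \<or> (\<exists>x\<in>X. P (Some x))"
  unfolding dirs_def by auto

lemma wt_simps [simp]: "wt \<tau> None = \<tau>" "wt \<tau> (Some x) = \<omega> x"
  unfolding wt_def by simp_all

lemma wt_pos: "\<tau> > 0 \<Longrightarrow> i \<in> dirs \<Longrightarrow> wt \<tau> i > 0"
  by (cases i) (auto simp: omega_pos)

lemma wt_nonneg: "\<tau> \<ge> 0 \<Longrightarrow> i \<in> dirs \<Longrightarrow> wt \<tau> i \<ge> 0"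
  by (cases i) (auto simp: omega_pos less_imp_le)

lemma tens_nonneg: "tens s \<ge> 0"
  using c_pos by (simp add: tens_def split: prod.split)

lemma D_nonneg: "\<tau> \<ge> 0 \<Longrightarrow> D \<tau> n s \<ge> 0"
  by (intro T.dder_nonneg wt_nonneg tens_nonneg)

text \<open>A step raises \<gamma> by at most one. Conversely, while \<open>\<gamma> S < R\<close>
  some element raises it and preserves independence, and after that steps in the direction
  \<open>None\<close>, of positive weight, use up the remaining order.\<close>

lemma D_pos_iff:
  assumes "\<tau> > 0"
  shows "D \<tau> n (a, S, b) > 0 \<longleftrightarrow> b \<and> S \<in> \<I> \<and> R \<le> \<gamma> S + n"
proof (induction n arbitrary: a S b)
  case 0
  show ?case
    using c_pos quot_le_top[of S] indep_subset_ground[of S] by (auto simp: tens_def)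
next
  case (Suc n)
  have "D \<tau> (Suc n) (a, S, b) \<noteq> 0 \<longleftrightarrow> (\<exists>i\<in>dirs. wt \<tau> i * D \<tau> n (tstep i (a, S, b)) \<noteq> 0)"
    unfolding T.dder.simps using assms
    by (subst sum_nonneg_eq_0_iff)
      (auto intro!: mult_nonneg_nonneg wt_nonneg D_nonneg finite_dirs)
  moreover have "wt \<tau> i * D \<tau> n (tstep i (a, S, b)) \<noteq> 0 \<longleftrightarrow> D \<tau> n (tstep i (a, S, b)) > 0" if "i \<in> dirs" for i
    using wt_pos[OF assms that] D_nonneg[of \<tau> n "tstep i (a, S, b)"] assms by auto
  moreover have "D \<tau> (Suc n) (a, S, b) > 0 \<longleftrightarrow> D \<tau> (Suc n) (a, S, b) \<noteq> 0"
    using D_nonneg[of \<tau> "Suc n" "(a, S, b)"] assms by (simp only: less_le) auto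
  ultimately have "D \<tau> (Suc n) (a, S, b) > 0 \<longleftrightarrow> (\<exists>i\<in>dirs. D \<tau> n (tstep i (a, S, b)) > 0)"
    by (metis (no_types, lifting))
  also have "\<dots> \<longleftrightarrow> (b \<and> S \<in> \<I> \<and> R \<le> \<gamma> S + n) \<or>
      (\<exists>x\<in>X. b \<and> x \<notin> S \<and> insert x S \<in> \<I> \<and> R \<le> \<gamma> (insert x S) + n)"
    by (simp add: bex_dirs Suc.IH)
  also have "\<dots> \<longleftrightarrow> b \<and> S \<in> \<I> \<and> R \<le> \<gamma> S + Suc n"
  proof (intro iffI)
    assume "(b \<and> S \<in> \<I> \<and> R \<le> \<gamma> S + n) \<or>
      (\<exists>x\<in>X. b \<and> x \<notin> S \<and> insert x S \<in> \<I> \<and> R \<le> \<gamma> (insert x S) + n)"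
    then show "b \<and> S \<in> \<I> \<and> R \<le> \<gamma> S + Suc n"
    proof
      assume "\<exists>x\<in>X. b \<and> x \<notin> S \<and> insert x S \<in> \<I> \<and> R \<le> \<gamma> (insert x S) + n"
      then obtain x where x: "b" "insert x S \<in> \<I>" "R \<le> \<gamma> (insert x S) + n" by blast
      have "S \<in> \<I>" by (rule indep_mono[OF x(2)]) blast
      then show ?thesis using x quot_insert_le[OF indep_subset_ground[OF x(2)]] by simp
    qed simp
  next
    assume S: "b \<and> S \<in> \<I> \<and> R \<le> \<gamma> S + Suc n"
    show "(b \<and> S \<in> \<I> \<and> R \<le> \<gamma> S + n) \<or>
      (\<exists>x\<in>X. b \<and> x \<notin> S \<and> insert x S \<in> \<I> \<and> R \<le> \<gamma> (insert x S) + n)"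
    proof (cases "\<gamma> S < R")
      case True
      then obtain x where x: "x \<in> X" "\<gamma> S < \<gamma> (insert x S)"
        using quot_step indep_subset_ground S by metis
      then show ?thesis
        using indep_insert_if_quot_less[of S x] S by auto
    next
      case False
      then show ?thesis using S by simp
    qed
  qed
  finally show ?case .
qed

text \<open>If the missing amount of \<gamma> leaves room for one step \<open>None\<close>, every
  vertex of the support is joined to \<open>None\<close> by a path of length at most two. Otherwise
  each step must raise \<gamma>, and two vertices of the support are equal, adjacent, or have a
  common neighbour.\<close>

lemma D_connected:
  fixes u :: "'a option \<Rightarrow> real"
  assumes \<tau>: "\<tau> > 0"
    and u: "\<And>i j. i \<in> dirs \<Longrightarrow> j \<in> dirs \<Longrightarrow> D \<tau> n (tstep i (tstep j s)) > 0 \<Longrightarrow> u i = u j"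
    and i: "i \<in> dirs" "D \<tau> (Suc n) (tstep i s) > 0"
    and j: "j \<in> dirs" "D \<tau> (Suc n) (tstep j s) > 0"
  shows "u i = u j"
proof -
  obtain a S b where s: "s = (a, S, b)" by (cases s)
  have uN: "u None = u (Some y)"
    if "b" "y \<in> X" "y \<notin> S" "insert y S \<in> \<I>" "R \<le> \<gamma> (insert y S) + n" for y
    using u[of None "Some y"] that by (simp add: s D_pos_iff[OF \<tau>])
  have uS: "u (Some x) = u (Some y)"
    if "b" "x \<in> X" "y \<in> X" "y \<notin> S" "x \<noteq> y" "x \<notin> S" "insert x (insert y S) \<in> \<I>"
      "R \<le> \<gamma> (insert x (insert y S)) + n" for x y
    using u[of "Some x" "Some y"] that by (simp add: s D_pos_iff[OF \<tau>])
  have supp: "b \<and> x \<in> X \<and> x \<notin> S \<and> insert x S \<in> \<I> \<and> R \<le> \<gamma> (insert x S) + Suc n"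
    if "Some x \<in> dirs" "D \<tau> (Suc n) (tstep (Some x) s) > 0" for x
    using that by (simp add: s D_pos_iff[OF \<tau>] del: T.dder.simps)
  have suppN: "b \<and> S \<in> \<I> \<and> R \<le> \<gamma> S + Suc n" if "D \<tau> (Suc n) (tstep None s) > 0"
    using that by (simp add: s D_pos_iff[OF \<tau>] del: T.dder.simps)
  have via_None: "u None = u (Some x)"
    if R: "R \<le> \<gamma> S + Suc n" and x: "Some x \<in> dirs" "D \<tau> (Suc n) (tstep (Some x) s) > 0" for x
  proof (cases "R \<le> \<gamma> (insert x S) + n")
    case True
    then show ?thesis using supp[OF x] by (intro uN) auto
  next
    case False
    note sx = supp[OF x]
    then have xI: "insert x S \<in> \<I>" and xX: "insert x S \<subseteq> X" using indep_subset_ground by blast+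
    obtain y where y: "y \<in> X" "\<gamma> (insert x S) < \<gamma> (insert y (insert x S))"
      using quot_step[OF xX] False by auto
    note y' = indep_insert_if_quot_less[OF xI y]
    \<comment> \<open>By diminishing returns \<open>y\<close> raises \<gamma> already above
      \<open>S\<close>, which makes \<open>y\<close> adjacent to \<open>None\<close> as well as to
      \<open>x\<close>.\<close>
    have "\<gamma> S < \<gamma> (insert y S)"
      using y xX by (intro quot_diminishing[of y x S]) auto
    moreover have "insert y S \<in> \<I>" using y'(2) by (rule indep_mono) blast
    ultimately have "u None = u (Some y)" using sx y y' R by (intro uN) auto
    also have "u (Some y) = u (Some x)"
      using sx y y' False by (intro uS) (auto simp: insert_commute)
    finally show ?thesis .
  qed
  have via_Some: "u (Some x) = u (Some x')"
    if R: "\<not> R \<le> \<gamma> S + Suc n" and x: "Some x \<in> dirs" "D \<tau> (Suc n) (tstep (Some x) s) > 0"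
      and x': "Some x' \<in> dirs" "D \<tau> (Suc n) (tstep (Some x') s) > 0" for x x'
  proof -
    note sx = supp[OF x] and sx' = supp[OF x']
    have xI: "insert x S \<in> \<I>" and xX: "insert x S \<subseteq> X" using sx indep_subset_ground by blast+
    have xI': "insert x' S \<in> \<I>" and xX': "insert x' S \<subseteq> X" using sx' indep_subset_ground by blast+
    have gx: "\<gamma> (insert x S) = Suc (\<gamma> S)" "R = \<gamma> S + Suc (Suc n)"
      using quot_insert_le[OF xX] R sx by auto
    have gx': "\<gamma> (insert x' S) = Suc (\<gamma> S)"
      using quot_insert_le[OF xX'] R sx' by auto
    consider "x = x'" | "x \<noteq> x'" "\<gamma> (insert x S) < \<gamma> (insert x' (insert x S))"
      | "x \<noteq> x'" "\<not> \<gamma> (insert x S) < \<gamma> (insert x' (insert x S))" by blast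
    then show ?thesis
    proof cases
      case 2
      have "x' \<in> X" using sx' by blast
      note t = indep_insert_if_quot_less[OF xI this 2(2)]
      then have "u (Some x') = u (Some x)"
        using sx sx' gx by (intro uS) auto
      then show ?thesis by simp
    next
      case 3
      \<comment> \<open>Here \<open>x\<close> and \<open>x'\<close> are parallel for \<gamma> above
        \<open>S\<close>. An element \<open>y\<close> that raises \<gamma> above
        \<open>insert x S\<close> then also raises it above \<open>insert x' S\<close>, so it is a
        neighbour of both.\<close>
      have subxx': "insert x' (insert x S) \<subseteq> X" using xX xX' by blast
      then have gxx': "\<gamma> (insert x' (insert x S)) = Suc (\<gamma> S)"
        using 3(2) gx quot_insert_ge[OF subxx'] by simp
      obtain y where y: "y \<in> X" "\<gamma> (insert x S) < \<gamma> (insert y (insert x S))"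
        using quot_step[OF xX] gx by auto
      note y' = indep_insert_if_quot_less[OF xI y]
      have suby: "insert y (insert x (insert x' S)) \<subseteq> X" using xX xX' y by blast
      have "\<gamma> (insert y (insert x S)) \<le> \<gamma> (insert y (insert x (insert x' S)))"
        using suby by (intro quot_mono) auto
      then have "\<gamma> (insert x (insert x' S)) < \<gamma> (insert y (insert x (insert x' S)))"
        using y' gx gxx' by (simp add: insert_commute)
      then have lt: "\<gamma> (insert x' S) < \<gamma> (insert y (insert x' S))"
        using suby by (intro quot_diminishing[of y x "insert x' S"])
      note y'' = indep_insert_if_quot_less[OF xI' y(1) lt]
      have "u (Some y) = u (Some x)" using sx y y' gx by (intro uS) auto
      moreover have "u (Some y) = u (Some x')" using sx' y y'' gx gx' by (intro uS) auto
      ultimately show ?thesis by simp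
    qed simp
  qed
  show ?thesis
  proof (cases "R \<le> \<gamma> S + Suc n")
    case True
    have "u None = u i" using via_None[OF True] i by (cases i) auto
    moreover have "u None = u j" using via_None[OF True] j by (cases j) auto
    ultimately show ?thesis by simp
  next
    case False
    have "i \<noteq> None" "j \<noteq> None" using suppN False i(2) j(2) by metis+
    then obtain x x' where "i = Some x" "j = Some x'" by auto
    then show ?thesis using via_Some[OF False, of x x'] i j by simp
  qed
qed

end

text \<open>For a multipartite graph with \<open>p\<close> classes, \<open>W\<close> is the total,
  \<open>V\<close> the sum of the squared class totals and \<open>t\<close> the coordinate of an
  extra vertex with a loop of weight \<open>e\<close>. Cauchy-Schwarz over the classes supplies the
  bound on \<open>W\<close>. The extremal loop weight
  \<open>1 / (1 - 1 / p) = 1 + 1 / (p - 1)\<close> is the origin of the constant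
  \<open>c\<close>.\<close>

lemma extended_multipartite_nonpos:
  fixes W V t p e :: real
  assumes p: "p \<ge> 1" and e: "e * (1 - 1 / p) \<le> 1" and t: "t = - (1 - 1 / p) * W" and V: "W\<^sup>2 \<le> p * V"
  shows "e * t\<^sup>2 + 2 * t * W + W\<^sup>2 - V \<le> 0"
proof -
  define \<alpha> where "\<alpha> = 1 - 1 / p"
  have \<alpha>: "\<alpha> \<ge> 0" "e * \<alpha> \<le> 1" using p e by (auto simp: \<alpha>_def)
  have "e * t\<^sup>2 + 2 * t * W + W\<^sup>2 - V = (e * \<alpha>) * (\<alpha> * W\<^sup>2) - 2 * \<alpha> * W\<^sup>2 + W\<^sup>2 - V"
    unfolding t \<alpha>_def[symmetric] by (simp add: power2_eq_square)
  also have "\<dots> \<le> 1 * (\<alpha> * W\<^sup>2) - 2 * \<alpha> * W\<^sup>2 + W\<^sup>2 - V"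
    using \<alpha> by (intro diff_right_mono add_right_mono mult_right_mono) auto
  also have "\<dots> = W\<^sup>2 / p - V" by (simp add: \<alpha>_def algebra_simps)
  also have "\<dots> \<le> 0" using V p by (simp add: field_simps)
  finally show ?thesis .
qed

section \<open>The base forms, of order zero\<close>

context weighted_quotient
begin

text \<open>When \<open>S\<close> is not a basis there is no loop at \<open>None\<close>, and up to
  the scaling \<sigma> the form is that of a graph. The work lies in cotransitivity of adjacency;
  edges exist only if one or two units of \<gamma> are missing.\<close>

lemma rev_CS_base_unsaturated:
  assumes \<tau>: "\<tau> \<ge> 0" and S: "S \<in> \<I>" and less: "\<gamma> S < R"
  shows "rev_CS dirs (\<lambda>i j. tens (tstep i (tstep j (a, S, True)))) (wt \<tau>)"
proof (rule rev_CS_if_nonpos_hyperplane)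
  let ?q = "\<lambda>i j. tens (tstep i (tstep j (a, S, True)))"
  show "bform dirs ?q (wt \<tau>) (wt \<tau>) \<ge> 0"
    using D_nonneg[OF \<tau>, of "Suc (Suc 0)" "(a, S, True)"]
      T.bform_dder_diag[of dirs "wt \<tau>" tens 0 "(a, S, True)"] by (simp del: T.dder.simps(2))
  define A where "A x \<longleftrightarrow> x \<notin> S \<and> insert x S \<in> \<I> \<and> \<gamma> (insert x S) = R" for x
  define B where "B x y \<longleftrightarrow> x \<noteq> y \<and> x \<notin> S \<and> y \<notin> S \<and> insert x (insert y S) \<in> \<I>
    \<and> \<gamma> (insert x (insert y S)) = R" for x y
  define adj :: "'a option \<Rightarrow> 'a option \<Rightarrow> bool"
    where "adj i j = (case (i, j) of (None, None) \<Rightarrow> False | (None, Some x) \<Rightarrow> A x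
      | (Some x, None) \<Rightarrow> A x | (Some x, Some y) \<Rightarrow> B x y)" for i j
  have adj_simps [simp]: "adj None None = False" "adj None (Some x) = A x" "adj (Some x) None = A x"
    "adj (Some x) (Some y) = B x y" for x y
    by (simp_all add: adj_def)
  define K where "K = {i \<in> dirs. \<exists>j\<in>dirs. adj i j}"
  \<comment> \<open>A step \<open>None\<close> multiplies the weight by \<open>c\<close>, except
    from \<open>a = 0\<close> to \<open>a = 1\<close>, where the truncated exponent does not
    change.\<close>
  define \<sigma> where "\<sigma> i = (if i = None \<and> a \<noteq> 0 then c else 1)" for i :: "'a option"
  have Bsym: "B y x" if "B x y" for x y using that by (auto simp: B_def insert_commute)
  have sub: "S \<subseteq> X" using S by (rule indep_subset_ground)
  have mem_X: "x \<in> X" if "insert x T \<in> \<I>" for x T using indep_subset_ground[OF that] by blast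
  have up: "A x \<or> B x y"
    if "insert x S \<in> \<I>" "x \<notin> S" "\<gamma> (insert y (insert x S)) = R" "y \<in> X" for x y
  proof (cases "\<gamma> (insert x S) = R")
    case True
    then show ?thesis using that by (simp add: A_def)
  next
    case False
    then have lt: "\<gamma> (insert x S) < \<gamma> (insert y (insert x S))"
      using quot_le_top[OF indep_subset_ground[OF that(1)]] that(3) by simp
    show ?thesis
      using indep_insert_if_quot_less[OF that(1,4) lt] that by (auto simp: B_def insert_commute)
  qed
  \<comment> \<open>Cotransitivity of an edge between \<open>None\<close> and \<open>x\<close>
    against a third vertex \<open>y\<close>: together \<open>x\<close> and \<open>y\<close> reach
    \<open>R\<close>, so \<open>y\<close> either reaches it alone or is completed by
    \<open>x\<close>.\<close>
  have A_or_B: "A y \<or> B y x" if "A x" "y \<notin> S" "insert y S \<in> \<I>" for x y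
  proof (rule up)
    have "insert x (insert y S) \<subseteq> X" using that mem_X sub by (auto simp: A_def)
    then have "\<gamma> (insert x (insert y S)) \<le> R" "\<gamma> (insert x S) \<le> \<gamma> (insert x (insert y S))"
      by (auto intro: quot_le_top quot_mono)
    then show "\<gamma> (insert x (insert y S)) = R" using that(1) by (simp add: A_def)
    show "x \<in> X" using that mem_X by (auto simp: A_def)
  qed (use that in auto)
  \<comment> \<open>Cotransitivity of an edge \<open>x\<close>, \<open>z\<close> against the vertex
    \<open>None\<close>, which is non-isolated only if a single unit of \<gamma> is missing.\<close>
  have one: "A x \<or> A z" if "B x z" "R = Suc (\<gamma> S)" for x z
  proof -
    have xz: "insert x (insert z S) \<in> \<I>" using that by (simp add: B_def)
    then have I: "insert x S \<in> \<I>" "insert z S \<in> \<I>" by (blast intro: indep_mono)+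
    show ?thesis
    proof (cases "\<gamma> (insert z S) = R")
      case True
      then show ?thesis using that I by (simp add: A_def B_def)
    next
      case False
      then have "\<gamma> (insert z S) < \<gamma> (insert x (insert z S))"
        using that quot_le_top[OF indep_subset_ground[OF I(2)]] by (simp add: B_def)
      then have "\<gamma> S < \<gamma> (insert x S)"
        by (intro quot_diminishing[OF indep_subset_ground[OF xz]])
      then have "\<gamma> (insert x S) = R"
        using that(2) quot_le_top[OF indep_subset_ground[OF I(1)]] by simp
      then show ?thesis using that I by (simp add: A_def B_def)
    qed
  qed
  \<comment> \<open>Cotransitivity of an edge \<open>x\<close>, \<open>z\<close> against an element
    \<open>y\<close>. With one missing unit it follows from \<open>one\<close> and
    \<open>A_or_B\<close>, or from parallelism in the matroid if \<open>y\<close> alone reaches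
    \<open>R\<close>; with two missing units it comes from the growth of \<gamma>.\<close>
  have two: "B x y \<or> B y z"
    if xz: "B x z" and y: "y \<notin> S" "insert y S \<in> \<I>" and yK: "A y \<or> (\<exists>y'. B y y')" for x y z
  proof (cases "R = Suc (\<gamma> S)")
    case True
    have I: "insert x S \<in> \<I>" "insert z S \<in> \<I>"
      using xz unfolding B_def by (blast intro: indep_mono)+
    have "A y \<or> B y x \<or> B y z"
      using one[OF xz True] A_or_B[of x y] A_or_B[of z y] y by blast
    moreover have "B x y \<or> B y z" if Ay: "A y"
    proof -
      have *: "\<gamma> (insert y (insert t S)) = R" if "insert y (insert t S) \<in> \<I>" for t
      proof (rule antisym)
        show "\<gamma> (insert y (insert t S)) \<le> R"
          by (rule quot_le_top[OF indep_subset_ground[OF that]])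
        have "\<gamma> (insert y S) \<le> \<gamma> (insert y (insert t S))"
          using indep_subset_ground[OF that] by (intro quot_mono) auto
        then show "R \<le> \<gamma> (insert y (insert t S))" using Ay by (simp add: A_def)
      qed
      have "(x \<noteq> y \<and> insert x (insert y S) \<in> \<I>) \<or> (y \<noteq> z \<and> insert y (insert z S) \<in> \<I>)"
        using xz y I by (intro parallel_trans) (auto simp: B_def Cont_iff)
      then show ?thesis
        using *[of x] *[of z] xz y by (auto simp: B_def insert_commute)
    qed
    ultimately show ?thesis using Bsym by blast
  next
    case False
    have xzI: "insert x (insert z S) \<in> \<I>" and xzR: "\<gamma> (insert x (insert z S)) = R"
      using xz by (auto simp: B_def)
    have yX: "insert y S \<subseteq> X" by (rule indep_subset_ground[OF y(2)])
    have zX: "insert z S \<subseteq> X" using indep_subset_ground[OF xzI] by blast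
    have R2: "R = \<gamma> S + 2"
      using quot_insert_le[OF indep_subset_ground[OF xzI]] quot_insert_le[OF zX] xzR False less by simp
    have gy: "\<gamma> (insert y S) = Suc (\<gamma> S)"
    proof -
      have "\<not> A y" using quot_insert_le[OF yX] R2 by (simp add: A_def)
      then obtain y' where y': "B y y'" using yK by blast
      then have "insert y' (insert y S) \<subseteq> X"
        using indep_subset_ground[of "insert y (insert y' S)"] by (auto simp: B_def)
      from quot_insert_le[OF this] have "R \<le> Suc (\<gamma> (insert y S))"
        using y' by (simp add: B_def insert_commute)
      then show ?thesis using R2 quot_insert_le[OF yX] by simp
    qed
    have TX: "insert x (insert z (insert y S)) \<subseteq> X"
      using indep_subset_ground[OF xzI] yX by blast
    then have "\<gamma> (insert x (insert z S)) \<le> \<gamma> (insert x (insert z (insert y S)))"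
      by (intro quot_mono) auto
    then have "\<exists>t\<in>insert x (insert z (insert y S)). \<gamma> (insert y S) < \<gamma> (insert t (insert y S))"
      using TX xzR gy R2 by (intro quot_grow) auto
    then obtain t where t: "t = x \<or> t = z" "\<gamma> (insert y S) < \<gamma> (insert t (insert y S))"
      by (auto simp: insert_absorb)
    have "t \<in> X" using t(1) TX by blast
    from indep_insert_if_quot_less[OF y(2) this t(2)] have "B t y"
      using gy R2 y by (auto simp: B_def)
    then show ?thesis using t(1) Bsym by blast
  qed
  have K_Some: "y \<notin> S \<and> insert y S \<in> \<I> \<and> (A y \<or> (\<exists>y'. B y y'))" if yK: "Some y \<in> K" for y
  proof -
    obtain j where "adj (Some y) j" using yK unfolding K_def by blast
    then have AB: "A y \<or> (\<exists>y'. B y y')" by (cases j) auto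
    have "insert y S \<in> \<I>" if "insert y (insert y' S) \<in> \<I>" for y'
      using that by (rule indep_mono) blast
    then show ?thesis using AB by (auto simp: A_def B_def)
  qed
  have K_None: "R = Suc (\<gamma> S)" if NK: "None \<in> K"
  proof -
    obtain j where "adj None j" using NK unfolding K_def by blast
    then obtain x where "A x" by (cases j) auto
    then have "insert x S \<in> \<I>" "\<gamma> (insert x S) = R" by (auto simp: A_def)
    then show ?thesis using quot_insert_le[OF indep_subset_ground[of "insert x S"]] less by simp
  qed
  fix z :: "'a option \<Rightarrow> real"
  assume zero: "(\<Sum>i\<in>dirs. (if i \<in> K then \<sigma> i else 0) * z i) = 0"
  show "bform dirs ?q z z \<le> 0"
  proof (rule bform_multipartite_nonpos[OF finite_dirs _ _ K_def _ _ _ zero])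
    show "c ^ (a - 1) \<ge> 0" using c_pos by simp
    fix i j :: "'a option"
    show "\<not> adj i i" by (cases i) (auto simp: B_def)
    show "adj i j \<Longrightarrow> adj j i" by (cases i; cases j) (auto dest: Bsym)
    have pow: "c ^ (Suc a - 1) = c ^ (a - 1) * \<sigma> None"
      by (cases a) (simp_all add: \<sigma>_def)
    show "?q i j = c ^ (a - 1) * (\<sigma> i * \<sigma> j * (if adj i j then 1 else 0))"
      using less pow by (cases i; cases j)
        (auto simp: tens_def A_def B_def \<sigma>_def insert_commute)
  next
    fix i j l assume "i \<in> dirs" "l \<in> dirs" and j: "j \<in> K" and il: "adj i l"
    show "adj i j \<or> adj j l"
    proof (cases i)
      case None
      then obtain x where x: "l = Some x" "A x" using il by (cases l) auto
      show ?thesis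
      proof (cases j)
        case (Some y)
        then show ?thesis using A_or_B[OF x(2), of y] K_Some[of y] j None x by auto
      qed (use x in auto)
    next
      case i: (Some x)
      show ?thesis
      proof (cases l)
        case None
        then have "A x" using il i by simp
        show ?thesis
        proof (cases j)
          case (Some y)
          then show ?thesis using A_or_B[OF \<open>A x\<close>, of y] K_Some[of y] j None i Bsym by auto
        qed (use \<open>A x\<close> i in auto)
      next
        case l: (Some z)
        then have "B x z" using il i by simp
        show ?thesis
        proof (cases j)
          case None
          then show ?thesis using one[OF \<open>B x z\<close>] K_None j i l by auto
        next
          case (Some y)
          then show ?thesis using two[OF \<open>B x z\<close>, of y] K_Some[of y] j i l by auto
        qed
      qed
    qed
  qed
next
  show "\<And>i j. tens (tstep i (tstep j (a, S, True))) = tens (tstep j (tstep i (a, S, True)))"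
    by (simp add: tstep_commute)
qed

text \<open>All independent supersets of a basis are bases, so the form is that of the complete
  multipartite graph on \<open>Par X \<I> S\<close>, extended by a vertex \<open>None\<close> joined
  to every element. Its loop has relative weight \<open>c\<close> at \<open>a = 0\<close> and 1 at
  larger \<open>a\<close>.\<close>

lemma rev_CS_base_saturated:
  assumes \<tau>: "\<tau> \<ge> 0" and S: "S \<in> \<I>" and sat: "\<gamma> S = R"
    and rank: "card S + 2 \<le> matroid_rank \<I> X"
    and c: "a = 0 \<Longrightarrow> c * (1 - 1 / real (card (Par X \<I> S))) \<le> 1"
  shows "rev_CS dirs (\<lambda>i j. tens (tstep i (tstep j (a, S, True)))) (wt \<tau>)"
proof (rule rev_CS_if_nonpos_hyperplane)
  let ?q = "\<lambda>i j. tens (tstep i (tstep j (a, S, True)))"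
  show "bform dirs ?q (wt \<tau>) (wt \<tau>) \<ge> 0"
    using D_nonneg[OF \<tau>, of "Suc (Suc 0)" "(a, S, True)"]
      T.bform_dder_diag[of dirs "wt \<tau>" tens 0 "(a, S, True)"] by (simp del: T.dder.simps(2))
  define C0 where "C0 = Cont X \<I> S"
  define r where "r = parallel_rel X \<I> S"
  define p where "p = real (card (Par X \<I> S))"
  define \<sigma> where "\<sigma> = (if a = 0 then 1 else c)"
  define e where "e = (if a = 0 then c else 1)"
  define \<kappa> where "\<kappa> = c ^ (a - 1)"
  have p: "p \<ge> 2" using card_Par_ge_2[OF S rank] by (simp add: p_def)
  have e: "e * (1 - 1 / p) \<le> 1" using c p by (auto simp: e_def p_def)
  have C0X: "C0 \<subseteq> X" and finC0: "finite C0"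
    using finite_Cont by (auto simp: C0_def Cont_def)
  fix z :: "'a option \<Rightarrow> real"
  define f where "f x = z (Some x)" for x
  \<comment> \<open>On this hyperplane \<open>t = - (1 - 1 / p) * W\<close>, the minimizer of
    \<open>e * t\<^sup>2 + 2 * t * W\<close> at the extremal loop weight
    \<open>e = 1 / (1 - 1 / p)\<close>.\<close>
  assume zero: "(\<Sum>i\<in>dirs. (case i of None \<Rightarrow> \<sigma> | Some x \<Rightarrow> if x \<in> C0 then 1 - 1 / p else 0) * z i) = 0"
  define t where "t = \<sigma> * z None"
  define W where "W = (\<Sum>x\<in>C0. f x)"
  define V where "V = (\<Sum>C\<in>Par X \<I> S. (\<Sum>x\<in>C. f x)\<^sup>2)"
  have to_C0: "(\<Sum>x\<in>X. if x \<in> C0 then g x else 0) = (\<Sum>x\<in>C0. g x)" for g :: "'a \<Rightarrow> real"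
    using C0X finite_ground by (intro sum.mono_neutral_cong_right) auto
  have "(\<Sum>x\<in>X. (if x \<in> C0 then 1 - 1 / p else 0) * f x) = (1 - 1 / p) * W"
    unfolding W_def sum_distrib_left to_C0[symmetric] by (intro sum.cong) auto
  then have tW: "t = - (1 - 1 / p) * W"
    using zero by (simp add: sum_dirs t_def f_def algebra_simps)
  have V: "W\<^sup>2 \<le> p * V"
  proof -
    have "W = (\<Sum>C\<in>Par X \<I> S. \<Sum>x\<in>C. f x)"
      unfolding W_def Par_def C0_def
      by (rule sum_quotient[OF finite_Cont equiv_parallel_rel, symmetric])
    then show ?thesis
      unfolding V_def p_def using sum_squared_le_sum_of_squares[of "\<lambda>C. \<Sum>x\<in>C. f x" "Par X \<I> S"]
      by (simp add: mult.commute)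
  qed
  have sat': "\<gamma> T = R" if "T \<in> \<I>" "S \<subseteq> T" for T
    using quot_mono[OF that(2) indep_subset_ground[OF that(1)]]
      quot_le_top[OF indep_subset_ground[OF that(1)]] sat by simp
  have qNN: "?q None None = \<kappa> * e * \<sigma>\<^sup>2"
    using S sat by (cases a) (auto simp: tens_def \<kappa>_def e_def \<sigma>_def power2_eq_square)
  have qN: "?q None (Some x) = (if x \<in> C0 then \<kappa> * \<sigma> else 0)"
    "?q (Some x) None = (if x \<in> C0 then \<kappa> * \<sigma> else 0)" for x
    using sat'[of "insert x S"]
    by (cases a; auto simp: tens_def \<kappa>_def \<sigma>_def C0_def Cont_iff)+
  have q2: "?q (Some x) (Some y) = (if x \<in> C0 \<and> y \<in> C0 \<and> (x, y) \<notin> r then \<kappa> else 0)" for x y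
  proof -
    have "insert x S \<in> \<I>" "insert y S \<in> \<I>" if "insert x (insert y S) \<in> \<I>"
      using that by (blast intro: indep_mono)+
    then show ?thesis
      using sat'[of "insert x (insert y S)"]
      by (auto simp: tens_def \<kappa>_def C0_def r_def parallel_rel_iff Cont_iff)
  qed
  have "(\<Sum>x\<in>X. \<Sum>y\<in>X. ?q (Some x) (Some y) * f x * f y)
      = (\<Sum>x\<in>C0. \<Sum>y\<in>C0. \<kappa> * (f x * f y) - \<kappa> * (if (x, y) \<in> r then f x * f y else 0))"
  proof -
    have "(\<Sum>x\<in>X. \<Sum>y\<in>X. ?q (Some x) (Some y) * f x * f y)
        = (\<Sum>x\<in>C0. \<Sum>y\<in>X. ?q (Some x) (Some y) * f x * f y)"
      using C0X finite_ground by (intro sum.mono_neutral_right) (auto simp: q2 simp del: tstep.simps)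
    also have "\<dots> = (\<Sum>x\<in>C0. \<Sum>y\<in>C0. ?q (Some x) (Some y) * f x * f y)"
      using C0X finite_ground by (intro sum.cong refl sum.mono_neutral_right) (auto simp: q2 simp del: tstep.simps)
    also have "\<dots> = (\<Sum>x\<in>C0. \<Sum>y\<in>C0. \<kappa> * (f x * f y) - \<kappa> * (if (x, y) \<in> r then f x * f y else 0))"
      by (intro sum.cong refl) (auto simp: q2 simp del: tstep.simps)
    finally show ?thesis .
  qed
  also have "\<dots> = \<kappa> * (\<Sum>x\<in>C0. \<Sum>y\<in>C0. f x * f y)
      - \<kappa> * (\<Sum>x\<in>C0. \<Sum>y\<in>C0. if (x, y) \<in> r then f x * f y else 0)"
    by (simp only: sum_subtractf sum_distrib_left)
  also have "(\<Sum>x\<in>C0. \<Sum>y\<in>C0. if (x, y) \<in> r then f x * f y else 0) = V"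
    unfolding V_def C0_def r_def Par_def by (rule sum_equiv_pairs[OF finite_Cont equiv_parallel_rel])
  also have "(\<Sum>x\<in>C0. \<Sum>y\<in>C0. f x * f y) = W\<^sup>2"
    unfolding W_def power2_eq_square by (rule sum_product[symmetric])
  finally have pairs: "(\<Sum>x\<in>X. \<Sum>y\<in>X. ?q (Some x) (Some y) * f x * f y) = \<kappa> * (W\<^sup>2 - V)"
    by (simp add: algebra_simps)
  have rowN: "(\<Sum>x\<in>X. ?q None (Some x) * z None * f x) = \<kappa> * t * W"
    "(\<Sum>x\<in>X. ?q (Some x) None * f x * z None) = \<kappa> * t * W"
    unfolding qN W_def sum_distrib_left to_C0[symmetric]
    by (intro sum.cong refl; simp add: t_def)+
  have "bform dirs ?q z z = ?q None None * z None * z None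
      + (\<Sum>x\<in>X. ?q None (Some x) * z None * f x) + ((\<Sum>x\<in>X. ?q (Some x) None * f x * z None)
      + (\<Sum>x\<in>X. \<Sum>y\<in>X. ?q (Some x) (Some y) * f x * f y))"
    unfolding bform_def sum_dirs f_def by (simp only: sum.distrib)
  also have "\<dots> = \<kappa> * (e * t\<^sup>2 + 2 * t * W + W\<^sup>2 - V)"
    unfolding pairs rowN qNN by (simp add: t_def power2_eq_square algebra_simps)
  also have "\<dots> \<le> 0"
    using extended_multipartite_nonpos[OF _ e tW V] p c_pos by (simp add: \<kappa>_def mult_nonneg_nonpos)
  finally show "bform dirs ?q z z \<le> 0" .
next
  show "\<And>i j. tens (tstep i (tstep j (a, S, True))) = tens (tstep j (tstep i (a, S, True)))"
    by (simp add: tstep_commute)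
qed

lemma rev_CS_base_invalid:
  assumes "\<not> (b \<and> S \<in> \<I>)"
  shows "rev_CS dirs (\<lambda>i j. tens (tstep i (tstep j (a, S, b)))) w"
proof -
  have "tens (tstep i (tstep j (a, S, b))) = 0" for i j
    using assms by (cases i; cases j) (auto simp: tens_def dest: indep_mono)
  then show ?thesis by (simp add: rev_CS_def bform_def)
qed

section \<open>Higher orders and the limit of vanishing weight \<tau>\<close>

definition bas :: "nat \<Rightarrow> 'a set set" where
  "bas j = {U \<in> \<I>. card U = j \<and> \<gamma> U = R}"

definition wsum :: "nat \<Rightarrow> real" where
  "wsum j = (\<Sum>U\<in>bas j. \<Prod>x\<in>U. \<omega> x)"

text \<open>Degree bookkeeping: after \<open>n\<close> further steps a valid state has degree
  \<open>m\<close>, which leaves two of the \<open>m + 2\<close> slots for the quadratic form.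
  Invalid states qualify vacuously, as their forms vanish.\<close>

definition level :: "nat \<Rightarrow> nat \<Rightarrow> nat \<times> 'a set \<times> bool \<Rightarrow> bool" where
  "level m n = (\<lambda>(a, S, b). b \<and> S \<in> \<I> \<longrightarrow> a + card S + n = m)"

lemma level_step:
  assumes "level m (Suc n) s"
  shows "level m n (tstep i s)"
proof -
  obtain a S b where s: "s = (a, S, b)" by (cases s)
  show ?thesis
  proof (cases i)
    case (Some x)
    have "insert x S \<in> \<I> \<Longrightarrow> S \<in> \<I>" by (erule indep_mono) blast
    then show ?thesis
      using assms Some s finite_indep[of S] by (auto simp: level_def)
  qed (use assms s in \<open>auto simp: level_def\<close>)
qed

lemma rev_CS_D_pos:
  assumes \<tau>: "\<tau> > 0" and rank: "m + 2 \<le> matroid_rank \<I> X"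
    and c: "\<And>S. S \<in> bas m \<Longrightarrow> c * (1 - 1 / real (card (Par X \<I> S))) \<le> 1"
  shows "level m n s \<Longrightarrow> rev_CS dirs (\<lambda>i j. D \<tau> n (tstep i (tstep j s))) (wt \<tau>)"
proof (rule T.rev_CS_dder[where P = "level m", OF finite_dirs wt_pos[OF \<tau>] tens_nonneg])
  fix s assume lev: "level m 0 s"
  obtain a S b where s: "s = (a, S, b)" by (cases s)
  show "rev_CS dirs (\<lambda>i j. tens (tstep i (tstep j s))) (wt \<tau>)"
  proof (cases "b \<and> S \<in> \<I>")
    case True
    then have S: "S \<in> \<I>" and s': "s = (a, S, True)" and card: "a + card S = m"
      using lev s by (auto simp: level_def)
    show ?thesis
    proof (cases "\<gamma> S < R")
      case True
      show ?thesis unfolding s' by (rule rev_CS_base_unsaturated[OF _ S True]) (use \<tau> in simp)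
    next
      case False
      then have sat: "\<gamma> S = R" using quot_le_top[OF indep_subset_ground[OF S]] by simp
      show ?thesis
        unfolding s'
      proof (rule rev_CS_base_saturated[OF _ S sat])
        show "card S + 2 \<le> matroid_rank \<I> X" using rank card by simp
        show "c * (1 - 1 / real (card (Par X \<I> S))) \<le> 1" if "a = 0"
          by (rule c) (use S sat card that in \<open>simp add: bas_def\<close>)
      qed (use \<tau> in simp)
    qed
  qed (use s rev_CS_base_invalid in simp)
next
  fix n s and u :: "'a option \<Rightarrow> real" and i j
  assume "\<And>i j. i \<in> dirs \<Longrightarrow> j \<in> dirs \<Longrightarrow> 0 < D \<tau> (Suc n) (tstep i (tstep j s)) \<Longrightarrow> u i = u j"
    and "i \<in> dirs" "j \<in> dirs" "0 < D \<tau> (Suc (Suc n)) (tstep i s)" "0 < D \<tau> (Suc (Suc n)) (tstep j s)"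
  then show "u i = u j" by (intro D_connected[OF \<tau>, of "Suc n" s u i j])
qed (assumption | rule level_step)+

lemma continuous_on_D: "continuous_on UNIV (\<lambda>\<tau>. D \<tau> n s)"
proof (induction n arbitrary: s)
  case (Suc n)
  have "continuous_on UNIV (\<lambda>\<tau>. wt \<tau> i)" for i
    by (cases i) (auto intro: continuous_intros)
  then show ?case by (simp, intro continuous_intros Suc.IH)
qed simp

text \<open>Trickle-down needs a positive weight on \<open>None\<close>. At \<tau> = 0 the
  inequality is recovered by continuity from the right.\<close>

lemma rev_CS_D_zero:
  assumes rank: "m + 2 \<le> matroid_rank \<I> X"
    and c: "\<And>S. S \<in> bas m \<Longrightarrow> c * (1 - 1 / real (card (Par X \<I> S))) \<le> 1"
    and lev: "level m n s"
  shows "rev_CS dirs (\<lambda>i j. D 0 n (tstep i (tstep j s))) (wt 0)"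
  unfolding rev_CS_def
proof
  fix v
  let ?b = "\<lambda>\<tau> u v. bform dirs (\<lambda>i j. D \<tau> n (tstep i (tstep j s))) u v"
  define f where "f \<tau> = ?b \<tau> (wt \<tau>) (wt \<tau>) * ?b \<tau> v v - (?b \<tau> (wt \<tau>) v)\<^sup>2" for \<tau>
  have wt: "continuous_on UNIV (\<lambda>\<tau>. wt \<tau> i)" for i
    by (cases i) (auto intro: continuous_intros)
  have "continuous_on UNIV f"
    unfolding f_def bform_def by (intro continuous_intros continuous_on_D wt)
  then have "(f \<longlongrightarrow> f 0) (at_right 0)"
    by (simp add: continuous_on_def filterlim_at_split)
  moreover have "\<forall>\<^sub>F \<tau> in at_right 0. f \<tau> \<le> 0"
    using eventually_at_right_less[of "0 :: real"]
  proof eventually_elim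
    case (elim \<tau>)
    then show ?case
      using rev_CS_D_pos[OF elim rank c lev] unfolding rev_CS_def f_def by simp
  qed
  ultimately have "f 0 \<le> 0" by (rule tendsto_upperbound) simp
  then show "?b 0 (wt 0) (wt 0) * ?b 0 v v \<le> (?b 0 (wt 0) v)\<^sup>2" by (simp add: f_def)
qed

section \<open>Derivatives at \<tau> = 0 as weighted counts of bases\<close>

lemma D_invalid: "\<not> (b \<and> S \<in> \<I>) \<Longrightarrow> D \<tau> n (a, S, b) = 0"
proof (induction n arbitrary: a S b)
  case (Suc n)
  have "D \<tau> n (tstep i (a, S, b)) = 0" for i
  proof (cases i)
    case (Some x)
    have "insert x S \<in> \<I> \<Longrightarrow> S \<in> \<I>" by (erule indep_mono) blast
    then show ?thesis using Some Suc.prems by (auto intro: Suc.IH)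
  qed (use Suc in simp)
  then show ?case by simp
qed (auto simp: tens_def)

lemma finite_bas: "finite (bas j)"
  unfolding bas_def using finite_indep_sets by simp

text \<open>Only steps along elements survive, and a basis \<open>U\<close> above \<open>S\<close>
  is reached once for each of the \<open>n!\<close> orderings of \<open>U - S\<close>.\<close>

lemma D_zero_eq:
  assumes "finite S"
  shows "D 0 n (a, S, True) =
    fact n * c ^ (a - 1) * (\<Sum>U\<in>{U \<in> bas (card S + n). S \<subseteq> U}. \<Prod>x\<in>U - S. \<omega> x)"
  using assms
proof (induction n arbitrary: S)
  case 0
  have "U = S" if "U \<in> \<I>" "card U = card S" "S \<subseteq> U" for U
    using card_subset_eq[OF finite_indep[OF that(1)] that(3)] that(2) by simp
  then have "{U \<in> bas (card S). S \<subseteq> U} = (if S \<in> \<I> \<and> \<gamma> S = R then {S} else {})"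
    by (auto simp: bas_def)
  then show ?case by (simp add: tens_def)
next
  case (Suc n)
  let ?N = "card S + Suc n"
  let ?f = "\<lambda>U. \<Prod>x\<in>U. \<omega> x"
  have "D 0 (Suc n) (a, S, True) = (\<Sum>x\<in>X. \<omega> x * D 0 n (a, insert x S, x \<notin> S))"
    by (simp add: sum_dirs)
  also have "\<dots> = (\<Sum>x\<in>X - S. \<omega> x * D 0 n (a, insert x S, True))"
    using finite_ground by (intro sum.mono_neutral_cong_right) (auto simp: D_invalid)
  also have "\<dots> = (\<Sum>x\<in>X - S. \<Sum>U | U \<in> {U \<in> bas ?N. S \<subseteq> U} \<and> x \<in> U. fact n * c ^ (a - 1) * ?f (U - S))"
  proof (rule sum.cong[OF refl])
    fix x assume x: "x \<in> X - S"
    let ?A = "{U. U \<in> {U \<in> bas ?N. S \<subseteq> U} \<and> x \<in> U}"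
    have A: "{U \<in> bas (card (insert x S) + n). insert x S \<subseteq> U} = {U. U \<in> {U \<in> bas ?N. S \<subseteq> U} \<and> x \<in> U}"
      using x Suc.prems by auto
    have f: "\<omega> x * ?f (U - insert x S) = ?f (U - S)" if U: "U \<in> ?A" for U
    proof -
      have "finite (U - S)" "x \<in> U - S" using U x finite_indep by (auto simp: bas_def)
      then have "?f (U - S) = \<omega> x * ?f (U - S - {x})" by (rule prod.remove)
      moreover have "U - S - {x} = U - insert x S" by blast
      ultimately show ?thesis by simp
    qed
    have "D 0 n (a, insert x S, True) = fact n * c ^ (a - 1) * (\<Sum>U\<in>?A. ?f (U - insert x S))"
      unfolding A[symmetric] using Suc.prems by (intro Suc.IH) simp
    then have "\<omega> x * D 0 n (a, insert x S, True)
        = (\<Sum>U\<in>?A. fact n * c ^ (a - 1) * (\<omega> x * ?f (U - insert x S)))"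
      by (simp only: sum_distrib_left mult.left_commute)
    also have "\<dots> = (\<Sum>U\<in>?A. fact n * c ^ (a - 1) * ?f (U - S))"
      by (intro sum.cong refl arg_cong2[of _ _ _ _ "(*)"] f)
    finally show "\<omega> x * D 0 n (a, insert x S, True)
      = (\<Sum>U\<in>?A. fact n * c ^ (a - 1) * ?f (U - S))" .
  qed
  \<comment> \<open>After the exchange of sums each \<open>U\<close> occurs once for every element
    of \<open>U - S\<close>, that is \<open>Suc n\<close> times.\<close>
  also have "\<dots> = (\<Sum>U\<in>{U \<in> bas ?N. S \<subseteq> U}. \<Sum>x | x \<in> X - S \<and> x \<in> U. fact n * c ^ (a - 1) * ?f (U - S))"
    by (rule sum.swap_restrict) (simp_all add: finite_ground finite_bas)
  also have "\<dots> = (\<Sum>U\<in>{U \<in> bas ?N. S \<subseteq> U}. fact (Suc n) * c ^ (a - 1) * ?f (U - S))"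
  proof (rule sum.cong[OF refl])
    fix U assume U: "U \<in> {U \<in> bas ?N. S \<subseteq> U}"
    then have "{x. x \<in> X - S \<and> x \<in> U} = U - S" using indep_subset_ground by (auto simp: bas_def)
    moreover have "card (U - S) = Suc n" using U Suc.prems by (simp add: card_Diff_subset bas_def)
    ultimately show "(\<Sum>x | x \<in> X - S \<and> x \<in> U. fact n * c ^ (a - 1) * ?f (U - S))
      = fact (Suc n) * c ^ (a - 1) * ?f (U - S)" by (simp add: algebra_simps)
  qed
  finally show ?case by (simp only: sum_distrib_left)
qed

lemma D_zero_empty: "D 0 n (a, {}, True) = fact n * c ^ (a - 1) * wsum n"
  using D_zero_eq[of "{}" n a] by (simp add: wsum_def del: T.dder.simps)

lemma prod_omega_pos: "U \<subseteq> X \<Longrightarrow> (\<Prod>x\<in>U. \<omega> x) > 0"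
  by (rule prod_pos) (use omega_pos in blast)

lemma D_zero_pos_iff:
  assumes "finite S"
  shows "D 0 n (a, S, True) > 0 \<longleftrightarrow> (\<exists>U\<in>bas (card S + n). S \<subseteq> U)"
proof -
  let ?B = "{U \<in> bas (card S + n). S \<subseteq> U}"
  have pos: "(\<Prod>x\<in>U - S. \<omega> x) > 0" if "U \<in> ?B" for U
    using that indep_subset_ground[of U] by (intro prod_omega_pos) (auto simp: bas_def)
  have "(\<Sum>U\<in>?B. \<Prod>x\<in>U - S. \<omega> x) > 0 \<longleftrightarrow> ?B \<noteq> {}"
  proof
    assume "?B \<noteq> {}"
    then show "(\<Sum>U\<in>?B. \<Prod>x\<in>U - S. \<omega> x) > 0"
      by (intro sum_pos pos) (use finite_bas in auto)
  next
    assume "(\<Sum>U\<in>?B. \<Prod>x\<in>U - S. \<omega> x) > 0"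
    then show "?B \<noteq> {}" by force
  qed
  moreover have "K * s > 0 \<longleftrightarrow> s > 0" if "K > 0" for K s :: real
    using that mult_pos_pos zero_less_mult_pos by blast
  moreover have "fact n * c ^ (a - 1) > 0" using c_pos by simp
  ultimately have "D 0 n (a, S, True) > 0 \<longleftrightarrow> ?B \<noteq> {}"
    unfolding D_zero_eq[OF assms] by presburger
  then show ?thesis by blast
qed

lemma wsum_pos_iff: "wsum j > 0 \<longleftrightarrow> bas j \<noteq> {}"
proof -
  have "D 0 j (0, {}, True) > 0 \<longleftrightarrow> wsum j > 0"
    unfolding D_zero_empty by (simp add: zero_less_mult_iff)
  moreover have "D 0 j (0, {}, True) > 0 \<longleftrightarrow> (\<exists>U\<in>bas (card ({} :: 'a set) + j). {} \<subseteq> U)"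
    by (rule D_zero_pos_iff) simp
  ultimately show ?thesis by (simp del: T.dder.simps) blast
qed

lemma wsum_nonneg: "wsum j \<ge> 0"
proof -
  have "U \<subseteq> X" if "U \<in> bas j" for U
    using that indep_subset_ground[of U] by (simp add: bas_def)
  then show ?thesis
    unfolding wsum_def by (intro sum_nonneg) (simp add: less_imp_le[OF prod_omega_pos])
qed

lemma bas_extend:
  assumes "U \<in> bas i" "i \<le> j" "j \<le> matroid_rank \<I> X"
  obtains V where "U \<subseteq> V" "V \<in> bas j"
proof -
  have U: "U \<in> \<I>" "U \<subseteq> X" "card U = i" "\<gamma> U = R"
    using assms(1) indep_subset_ground by (auto simp: bas_def)
  obtain V where V: "U \<subseteq> V" "V \<subseteq> X" "V \<in> \<I>" "card V = j"
    by (rule indep_extend[of U X j]) (use U assms in auto)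
  have "\<gamma> V = R" using quot_mono[OF V(1,2)] quot_le_top[OF V(2)] U(4) by simp
  then show ?thesis using V that[of V] by (simp add: bas_def)
qed

end

subsection \<open>The case of equality\<close>

lemma card_exchange:
  assumes "finite S" "y \<in> S" "x \<notin> S"
  shows "card (insert x (S - {y})) = card S"
  using assms card.remove[OF assms(1,2)] by simp

text \<open>The case of equality with \<open>m = k - 1\<close>; the bound on \<open>c\<close> is
  what the saturated base forms require.\<close>

locale extremal_quotient = weighted_quotient X \<I> \<gamma> R \<omega> c
  for X :: "'a set" and \<I> and \<gamma> and R and \<omega> and c +
  fixes m :: nat
  assumes rank: "m + 2 \<le> matroid_rank \<I> X"
    and c_gt_1: "c > 1"
    and c_bound: "S \<in> bas m \<Longrightarrow> c * (1 - 1 / real (card (Par X \<I> S))) \<le> 1"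
    and wsum_pos: "wsum (Suc m) > 0"
    and wsum_eq: "(wsum (Suc m))\<^sup>2 = (1 + 1 / real (Suc m)) * c * wsum m * wsum (m + 2)"
begin

definition Q :: "nat \<Rightarrow> nat \<times> 'a set \<times> bool \<Rightarrow> 'a option \<Rightarrow> 'a option \<Rightarrow> real" where
  "Q n s = (\<lambda>i j. D 0 n (tstep i (tstep j s)))"

lemma Q_sym: "Q n s i j = Q n s j i"
  unfolding Q_def by (simp only: tstep_commute)

lemma rev_CS_Q: "level m n s \<Longrightarrow> rev_CS dirs (Q n s) (wt 0)"
  unfolding Q_def by (rule rev_CS_D_zero[OF rank c_bound])

lemma bform_Q_wt: "bform dirs (Q n s) (wt 0) v = (\<Sum>j\<in>dirs. v j * D 0 (Suc n) (tstep j s))"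
  unfolding Q_def by (rule T.bform_dder)

lemma bform_Q_wt_wt: "bform dirs (Q n s) (wt 0) (wt 0) = D 0 (Suc (Suc n)) s"
  unfolding Q_def by (rule T.bform_dder_diag)

definition unit :: "'a option \<Rightarrow> 'a option \<Rightarrow> real" where
  "unit i = (\<lambda>j. if j = i then 1 else 0)"

lemma bform_unit: "i \<in> dirs \<Longrightarrow> bform dirs q (unit i) v = (\<Sum>j\<in>dirs. q i j * v j)"
proof -
  assume i: "i \<in> dirs"
  have "bform dirs q (unit i) v = (\<Sum>l\<in>dirs. if l = i then (\<Sum>j\<in>dirs. q l j * v j) else 0)"
    unfolding bform_def by (intro sum.cong refl) (simp add: unit_def)
  then show ?thesis using i finite_dirs by simp
qed

lemma bform_unit_None: "bform dirs q (unit None) (unit None) = q None None"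
  by (simp add: bform_unit) (simp add: unit_def if_distrib[of "\<lambda>x. _ * x"] finite_dirs cong: if_cong)

lemma bform_Q_wt_unit: "bform dirs (Q n s) (wt 0) (unit None) = D 0 (Suc n) (tstep None s)"
proof -
  have "bform dirs (Q n s) (wt 0) (unit None)
      = (\<Sum>j\<in>dirs. if j = None then D 0 (Suc n) (tstep j s) else 0)"
    unfolding bform_Q_wt by (intro sum.cong refl) (simp add: unit_def del: T.dder.simps)
  then show ?thesis using finite_dirs by (simp del: T.dder.simps)
qed

text \<open>Chosen so that \<open>nullv\<close> is the direction \<open>None\<close> made orthogonal
  to \<open>wt 0\<close> in the top form.\<close>

definition \<theta> :: real where "\<theta> = D 0 (Suc m) (1, {}, True) / D 0 (Suc (Suc m)) (0, {}, True)"

definition nullv :: "'a option \<Rightarrow> real" where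
  "nullv = (\<lambda>i. 1 * unit None i + (- \<theta>) * wt 0 i)"

lemma nullv_simps [simp]: "nullv None = 1" "nullv (Some x) = - \<theta> * \<omega> x"
  by (simp_all add: nullv_def unit_def)

lemma bform_Q_wt_nullv:
  "bform dirs (Q n s) (wt 0) nullv = D 0 (Suc n) (tstep None s) - \<theta> * D 0 (Suc (Suc n)) s"
  unfolding nullv_def bform_combine_right bform_Q_wt_unit bform_Q_wt_wt by (simp del: T.dder.simps)

lemma bform_Q_nullv_nullv:
  "bform dirs (Q n s) nullv nullv = Q n s None None - 2 * \<theta> * D 0 (Suc n) (tstep None s)
     + \<theta>\<^sup>2 * D 0 (Suc (Suc n)) s"
  unfolding nullv_def
  using bform_combine_diag[of dirs "Q n s" 1 "unit None" "- \<theta>" "wt 0", OF Q_sym]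
    bform_commute[of dirs "Q n s" "unit None" "wt 0", OF Q_sym]
  by (simp add: bform_unit_None bform_Q_wt_unit bform_Q_wt_wt del: T.dder.simps)

lemma wsum_m_pos: "wsum m > 0" and wsum_m2_pos: "wsum (m + 2) > 0"
proof -
  have "wsum m * wsum (m + 2) \<noteq> 0"
    using wsum_eq wsum_pos by auto
  then show "wsum m > 0" "wsum (m + 2) > 0"
    using wsum_nonneg[of m] wsum_nonneg[of "m + 2"] by (auto simp: less_le)
qed

lemma D_top: "D 0 (Suc (Suc m)) (0, {}, True) = fact (m + 2) * wsum (m + 2)"
  "D 0 (Suc m) (1, {}, True) = fact (m + 1) * wsum (Suc m)"
  "D 0 m (2, {}, True) = fact m * c * wsum m"
  unfolding D_zero_empty by simp_all

lemma \<theta>_pos: "\<theta> > 0"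
  unfolding \<theta>_def D_top using wsum_pos wsum_m2_pos by simp

text \<open>The equality hypothesis says that the Gram determinant of \<open>unit None\<close> and
  \<open>wt 0\<close> in the top form vanishes. Hence \<open>nullv\<close> is orthogonal to
  \<open>wt 0\<close> and null.\<close>

lemma kernel_top: "bform dirs (Q m (0, {}, True)) u nullv = 0"
proof (rule rev_CS_null_imp_kernel[OF Q_sym rev_CS_Q])
  let ?s = "(0, {}, True) :: nat \<times> 'a set \<times> bool"
  show "level m m ?s" by (simp add: level_def)
  have ww: "D 0 (Suc (Suc m)) ?s > 0"
    unfolding D_top using wsum_m2_pos by simp
  then show "bform dirs (Q m ?s) (wt 0) (wt 0) > 0" unfolding bform_Q_wt_wt .
  have step: "tstep None ?s = (1, {}, True)" by simp
  have wu: "D 0 (Suc m) (1, {}, True) = \<theta> * D 0 (Suc (Suc m)) ?s"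
    using ww unfolding \<theta>_def by (simp del: T.dder.simps)
  then show "bform dirs (Q m ?s) (wt 0) nullv = 0"
    unfolding bform_Q_wt_nullv step by simp
  have uu: "Q m ?s None None = fact m * c * wsum m"
    unfolding Q_def tstep.simps D_top(3)[symmetric] by (simp add: numeral_2_eq_2)
  \<comment> \<open>The factorials \<open>m!\<close>, \<open>(m + 1)!\<close> and
    \<open>(m + 2)!\<close> absorb the factor \<open>1 + 1 / (m + 1)\<close>.\<close>
  have "(D 0 (Suc m) (1, {}, True))\<^sup>2 = Q m ?s None None * D 0 (Suc (Suc m)) ?s"
    unfolding D_top uu power_mult_distrib wsum_eq
    by (simp add: power2_eq_square field_simps)
  then have "Q m ?s None None * D 0 (Suc (Suc m)) ?s = \<theta>\<^sup>2 * (D 0 (Suc (Suc m)) ?s)\<^sup>2"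
    unfolding wu by (simp only: power_mult_distrib)
  then have "Q m ?s None None = \<theta>\<^sup>2 * D 0 (Suc (Suc m)) ?s"
    using ww by (simp add: power2_eq_square del: T.dder.simps)
  then show "bform dirs (Q m ?s) nullv nullv = 0"
    unfolding bform_Q_nullv_nullv step wu by (simp add: power2_eq_square del: T.dder.simps)
qed

text \<open>The reverse Cauchy-Schwarz inequality is void when no basis of size \<open>m + 2\<close> contains the state; then the
  form vanishes at \<open>nullv\<close>, because a basis of size \<open>m\<close> would extend to one of size \<open>m + 1\<close>.\<close>

lemma bform_Q_nullv_nonpos:
  assumes lev: "level m n s" and orth: "bform dirs (Q n s) (wt 0) nullv = 0"
  shows "bform dirs (Q n s) nullv nullv \<le> 0"
proof (cases "D 0 (Suc (Suc n)) s > 0")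
  case True
  then show ?thesis
    using rev_CS_Q[OF lev] orth unfolding rev_CS_def bform_Q_wt_wt
    by (metis mult_le_0_iff not_le power_zero_numeral)
next
  case False
  then have ww: "D 0 (Suc (Suc n)) s = 0" using D_nonneg[of 0 "Suc (Suc n)" s] by linarith
  then have wu: "D 0 (Suc n) (tstep None s) = 0" using orth unfolding bform_Q_wt_nullv by simp
  obtain a S b where s: "s = (a, S, b)" by (cases s)
  have "Q n s None None = 0"
  proof (cases "b \<and> S \<in> \<I>")
    case True
    then have S: "S \<in> \<I>" "finite S" and b: "b = True" using finite_indep by auto
    have card: "a + card S + n = m" using lev True s by (simp add: level_def)
    show ?thesis
    proof (rule ccontr)
      assume "Q n s None None \<noteq> 0"
      then have "D 0 n (Suc (Suc a), S, True) > 0"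
        using D_nonneg[of 0 n "(Suc (Suc a), S, True)"] by (simp add: Q_def s b)
      then obtain U where U: "U \<in> bas (card S + n)" "S \<subseteq> U"
        unfolding D_zero_pos_iff[OF S(2)] by blast
      obtain V where V: "U \<subseteq> V" "V \<in> bas (card S + Suc n)"
        by (rule bas_extend[OF U(1), of "card S + Suc n"]) (use card rank in auto)
      then have "D 0 (Suc n) (Suc a, S, True) > 0"
        unfolding D_zero_pos_iff[OF S(2)] using U(2) by blast
      then show False using wu unfolding s b tstep.simps by linarith
    qed
  qed (simp add: Q_def s D_invalid)
  then show ?thesis unfolding bform_Q_nullv_nullv ww wu by simp
qed

text \<open>The elements of \<open>T\<close> are added one at a time. The parent form at
  \<open>nullv\<close> is zero and is a nonnegative combination of the nonpositive values of its
  children, so every child of positive weight is zero there. The basis \<open>U\<close> makes the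
  child positive at \<open>wt 0\<close>, so nullity gives the kernel.\<close>

lemma kernel_propagates:
  assumes "finite T" "T \<subseteq> U" "U \<in> bas (m + 2)" "card T + n = m"
  shows "bform dirs (Q n (0, T, True)) u nullv = 0"
  using assms
proof (induction T arbitrary: n u)
  case empty
  then show ?case using kernel_top by simp
next
  case (insert x T)
  let ?t = "(0, T, True) :: nat \<times> 'a set \<times> bool" and ?s = "(0, insert x T, True) :: nat \<times> 'a set \<times> bool"
  have U: "U \<in> \<I>" using insert.prems(2) by (simp add: bas_def)
  have T: "T \<in> \<I>" "insert x T \<in> \<I>" using insert.prems(1) by (auto intro: indep_mono[OF U])
  have xX: "x \<in> X" using indep_subset_ground[OF T(2)] by blast
  have ker: "bform dirs (Q (Suc n) ?t) u nullv = 0" for u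
    by (rule insert.IH) (use insert in auto)
  have lev0: "level m (Suc n) ?t" using insert by (simp add: level_def)
  have lev: "level m n (tstep l ?t)" for l by (rule level_step[OF lev0])
  have s: "tstep (Some x) ?t = ?s" using insert.hyps by simp
  \<comment> \<open>Testing the kernel of the parent form with \<open>unit l\<close> is
    orthogonality to \<open>wt 0\<close> in the child form of \<open>l\<close>.\<close>
  have orth: "bform dirs (Q n (tstep l ?t)) (wt 0) nullv = 0" if "l \<in> dirs" for l
  proof -
    have "bform dirs (Q n (tstep l ?t)) (wt 0) nullv = (\<Sum>j\<in>dirs. nullv j * D 0 (Suc n) (tstep j (tstep l ?t)))"
      by (rule bform_Q_wt)
    also have "\<dots> = bform dirs (Q (Suc n) ?t) (unit l) nullv"
      unfolding bform_unit[OF that] Q_def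
      by (intro sum.cong refl) (simp only: tstep_commute[of l] mult.commute)
    finally show ?thesis by (simp add: ker)
  qed
  have nonpos: "bform dirs (Q n (tstep l ?t)) nullv nullv \<le> 0" if "l \<in> dirs" for l
    by (rule bform_Q_nullv_nonpos[OF lev orth[OF that]])
  have "bform dirs (Q (Suc n) ?t) nullv nullv = (\<Sum>l\<in>dirs. wt 0 l * bform dirs (Q n (tstep l ?t)) nullv nullv)"
    unfolding Q_def by (rule T.bform_dder_Suc)
  then have "(\<Sum>l\<in>dirs. - (wt 0 l * bform dirs (Q n (tstep l ?t)) nullv nullv)) = 0"
    using ker by (simp add: sum_negf)
  then have "- (wt 0 (Some x) * bform dirs (Q n (tstep (Some x) ?t)) nullv nullv) = 0"
    using finite_dirs nonpos wt_nonneg[of 0] xX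
    by (intro sum_nonneg_0[where s = dirs and f = "\<lambda>l. - (wt 0 l * bform dirs (Q n (tstep l ?t)) nullv nullv)"])
      (auto simp: mult_nonneg_nonpos)
  then have null: "bform dirs (Q n ?s) nullv nullv = 0"
    using omega_pos[OF xX] unfolding s by simp
  show ?case
  proof (rule rev_CS_null_imp_kernel[OF Q_sym rev_CS_Q])
    show "level m n ?s" using lev[of "Some x"] unfolding s .
    show "bform dirs (Q n ?s) (wt 0) nullv = 0" using orth[of "Some x"] xX unfolding s by simp
    have "card (insert x T) + Suc (Suc n) = m + 2" using insert.prems(3) by simp
    then show "bform dirs (Q n ?s) (wt 0) (wt 0) > 0"
      unfolding bform_Q_wt_wt using insert.prems(1,2) insert.hyps(1)
      by (subst D_zero_pos_iff) auto
  qed (rule null)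
qed

text \<open>These are the kernel equations of the extended multipartite form. With \<open>W\<close>
  the weight of \<open>Cont X \<I> S\<close>, the row of \<open>None\<close> reads
  \<open>c = \<theta> * W\<close>, and the row of an element of a class \<open>C\<close> reads 1 =
  \<theta> times (\<open>W\<close> minus the weight of \<open>C\<close>). Summing the resulting
  class weights counts the classes.\<close>

lemma extremal_local:
  assumes U: "U \<in> bas (m + 2)" and SU: "S \<subseteq> U" and card: "card S = m"
  shows "\<gamma> S = R" "\<And>C. C \<in> Par X \<I> S \<Longrightarrow> (\<Sum>x\<in>C. \<omega> x) = (c - 1) / \<theta>"
    "real (card (Par X \<I> S)) = c / (c - 1)"
proof -
  let ?s = "(0, S, True) :: nat \<times> 'a set \<times> bool"
  have S: "S \<in> \<I>" using U SU by (auto simp: bas_def intro: indep_mono)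
  note fin = finite_indep[OF S]
  have ker: "bform dirs (Q 0 ?s) u nullv = 0" for u
    by (rule kernel_propagates[OF fin SU U]) (simp add: card)
  have top: "D 0 (Suc (Suc 0)) ?s > 0"
    unfolding D_zero_pos_iff[OF fin] using U SU card by auto
  have row: "Q 0 ?s i None = \<theta> * (\<Sum>x\<in>X. \<omega> x * Q 0 ?s i (Some x))" if "i \<in> dirs" for i
  proof -
    have "Q 0 ?s i None - \<theta> * (\<Sum>x\<in>X. \<omega> x * Q 0 ?s i (Some x)) = (\<Sum>j\<in>dirs. Q 0 ?s i j * nullv j)"
      unfolding sum_dirs by (simp add: sum_distrib_left sum_negf algebra_simps)
    also have "\<dots> = 0" using ker[of "unit i"] unfolding bform_unit[OF that] .
    finally show ?thesis by simp
  qed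
  have D1: "D 0 (Suc 0) (1, S, True) = (\<Sum>x\<in>X. \<omega> x * Q 0 ?s None (Some x))"
    by (simp add: sum_dirs Q_def)
  have "D 0 (Suc 0) (1, S, True) = \<theta> * D 0 (Suc (Suc 0)) ?s"
    using ker[of "wt 0"] unfolding bform_Q_wt_nullv by (simp del: T.dder.simps)
  \<comment> \<open>The row of \<open>None\<close> makes its loop entry a positive multiple of this
    derivative. A nonzero loop entry means that \<open>S\<close> is already a basis.\<close>
  then have "D 0 (Suc 0) (1, S, True) > 0" using top \<theta>_pos by (simp del: T.dder.simps)
  then have "Q 0 ?s None None > 0"
    unfolding row[OF None_dirs] D1[symmetric] using \<theta>_pos by (simp del: T.dder.simps)
  then show sat: "\<gamma> S = R" by (simp add: Q_def tens_def split: if_splits)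
  have sat': "\<gamma> T = R" if "T \<in> \<I>" "S \<subseteq> T" for T
    using quot_mono[OF that(2) indep_subset_ground[OF that(1)]]
      quot_le_top[OF indep_subset_ground[OF that(1)]] sat by simp
  define C0 where "C0 = Cont X \<I> S"
  define r where "r = parallel_rel X \<I> S"
  have eq: "equiv C0 r" and finC0: "finite C0" and C0X: "C0 \<subseteq> X"
    unfolding C0_def r_def using equiv_parallel_rel finite_Cont by (auto simp: Cont_def)
  have qNN: "Q 0 ?s None None = c" using S sat by (simp add: Q_def tens_def)
  have qN: "Q 0 ?s None (Some x) = (if x \<in> C0 then 1 else 0)"
    "Q 0 ?s (Some x) None = (if x \<in> C0 then 1 else 0)" for x
    using sat'[of "insert x S"] by (auto simp: Q_def tens_def C0_def Cont_iff)
  have q2: "Q 0 ?s (Some x) (Some y) = (if x \<in> C0 \<and> y \<in> C0 \<and> (x, y) \<notin> r then 1 else 0)" for x y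
  proof -
    have "insert x S \<in> \<I>" "insert y S \<in> \<I>" if "insert x (insert y S) \<in> \<I>"
      using that by (blast intro: indep_mono)+
    then show ?thesis
      using sat'[of "insert x (insert y S)"]
      by (auto simp: Q_def tens_def C0_def r_def parallel_rel_iff Cont_iff)
  qed
  define W where "W = (\<Sum>x\<in>C0. \<omega> x)"
  have to_C0: "(\<Sum>x\<in>X. \<omega> x * (if x \<in> C0 then g x else 0)) = (\<Sum>x\<in>C0. \<omega> x * g x)" for g :: "'a \<Rightarrow> real"
    using C0X finite_ground by (intro sum.mono_neutral_cong_right) auto
  have W: "c = \<theta> * W"
    using row[OF None_dirs] to_C0[of "\<lambda>_. 1"] unfolding qNN qN W_def by simp
  have class_sum: "(\<Sum>x\<in>C. \<omega> x) = (c - 1) / \<theta>" if C: "C \<in> C0 // r" for C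
  proof -
    obtain x where x: "x \<in> C0" "C = r `` {x}" using C by (rule quotientE)
    have CC0: "C \<subseteq> C0" by (rule in_quotient_imp_subset[OF eq C])
    have "1 = \<theta> * (\<Sum>y\<in>X. \<omega> y * Q 0 ?s (Some x) (Some y))"
      using row[of "Some x"] x C0X qN(2)[of x] by auto
    also have "(\<Sum>y\<in>X. \<omega> y * Q 0 ?s (Some x) (Some y)) = (\<Sum>y\<in>C0 - C. \<omega> y)"
      \<comment> \<open>The elements not adjacent to \<open>x\<close> within \<open>C0\<close> are
        exactly those of its class \<open>C\<close>.\<close>
      using C0X finite_ground x by (intro sum.mono_neutral_cong_right) (auto simp: q2)
    also have "\<dots> = W - (\<Sum>y\<in>C. \<omega> y)"
      unfolding W_def by (rule sum_diff[OF finC0 CC0])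
    finally show ?thesis using W \<theta>_pos by (simp add: field_simps)
  qed
  then show "(\<Sum>x\<in>C. \<omega> x) = (c - 1) / \<theta>" if "C \<in> Par X \<I> S" for C
    using that by (simp add: Par_def C0_def r_def)
  have "W = (\<Sum>C\<in>C0 // r. \<Sum>x\<in>C. \<omega> x)"
    unfolding W_def by (rule sum_quotient[OF finC0 eq, symmetric])
  also have "\<dots> = (\<Sum>C\<in>C0 // r. (c - 1) / \<theta>)" by (intro sum.cong refl class_sum)
  also have "\<dots> = real (card (Par X \<I> S)) * ((c - 1) / \<theta>)"
    by (simp add: Par_def C0_def r_def)
  finally have "c = real (card (Par X \<I> S)) * (c - 1)"
    using W \<theta>_pos by simp
  then show "real (card (Par X \<I> S)) = c / (c - 1)"
    using c_gt_1 by (simp add: field_simps)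
qed

text \<open>Some basis of size \<open>m\<close> exists and is moved to \<open>S'\<close> by
  exchanges, with induction on the number of elements of \<open>S'\<close> still missing.\<close>

lemma all_indep_bases:
  assumes "S' \<in> \<I>" "card S' = m"
  shows "S' \<in> bas m"
proof -
  have "S' \<in> bas m" if "S \<in> bas m" for S
    using that
  proof (induction "card (S' - S)" arbitrary: S)
    case 0
    have "finite S'" using assms(1) by (rule finite_indep)
    then have "S' \<subseteq> S" using 0(1) by auto
    moreover have "finite S" "card S = m" using 0(2) finite_indep by (auto simp: bas_def)
    ultimately show ?case using 0(2) assms(2) card_subset_eq by metis
  next
    case (Suc j)
    have S: "S \<in> \<I>" "card S = m" "\<gamma> S = R" using Suc.prems by (auto simp: bas_def)
    note fin = finite_indep[OF S(1)] finite_indep[OF assms(1)]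
    have "S' - S \<noteq> {}" using Suc.hyps(2) by force
    then obtain x where x: "x \<in> S' - S" by blast
    have xX: "x \<in> X" using x indep_subset_ground[OF assms(1)] by blast
    have "\<exists>y\<in>S - S'. insert x (S - {y}) \<in> bas m"
    proof (cases "insert x S \<in> \<I>")
      case True
      have "\<not> S \<subseteq> S'"
        using x S(2) assms(2) card_subset_eq[OF fin(2), of S] by auto
      then obtain y where y: "y \<in> S - S'" by blast
      have sub: "insert x S \<subseteq> X" by (rule indep_subset_ground[OF True])
      have "\<gamma> (insert x S) = R"
        using quot_insert_ge[OF sub] quot_le_top[OF sub] S(3) by simp
      then have "insert x S \<in> bas (Suc m)" using True S fin x by (simp add: bas_def)
      then obtain V where V: "insert x S \<subseteq> V" "V \<in> bas (m + 2)"
        by (rule bas_extend[of _ _ "m + 2"]) (use rank in auto)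
      have card: "card (insert x (S - {y})) = m"
        by (rule card_exchange[OF fin(1), of y x, unfolded S(2)]) (use x y in auto)
      \<comment> \<open>Independence of \<open>insert x S\<close> alone does not control \<gamma>
        after \<open>y\<close> is removed. The set \<open>V\<close> is a basis of size
        \<open>m + 2\<close>, and by \<open>extremal_local\<close> all its subsets of size
        \<open>m\<close> are bases.\<close>
      have "\<gamma> (insert x (S - {y})) = R"
        by (rule extremal_local(1)[OF V(2) _ card]) (use V(1) in auto)
      moreover have "insert x (S - {y}) \<in> \<I>" by (rule indep_mono[OF True]) auto
      ultimately show ?thesis using card y by (auto simp: bas_def)
    next
      case False
      obtain y where y: "y \<in> S - S'" "insert x (S - {y}) \<in> \<I>"
        by (rule indep_exchange[OF S(1) assms(1) x False])
      have "\<gamma> S \<le> \<gamma> (insert x (S - {y}))"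
        by (rule quot_exchange[OF S(1) False xX _ y(2)]) (use y in blast)
      then have "\<gamma> (insert x (S - {y})) = R"
        using S(3) quot_le_top[OF indep_subset_ground[OF y(2)]] by simp
      moreover have "card (insert x (S - {y})) = m"
        by (rule card_exchange[OF fin(1), of y x, unfolded S(2)]) (use x y in auto)
      ultimately show ?thesis using y by (auto simp: bas_def)
    qed
    then obtain y where y: "y \<in> S - S'" "insert x (S - {y}) \<in> bas m" by blast
    have "S' - insert x (S - {y}) = (S' - S) - {x}" using y by blast
    then have "j = card (S' - insert x (S - {y}))" using Suc.hyps(2) x fin by simp
    then show ?case using y(2) by (rule Suc.hyps(1))
  qed
  moreover have "bas m \<noteq> {}" using wsum_m_pos wsum_pos_iff by blast
  ultimately show ?thesis by blast
qed

lemma extremal_imp_uniform: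
  "\<exists>s>0. \<forall>S\<in>\<I>. card S = m \<longrightarrow> \<gamma> S = R \<and> (\<forall>C\<in>Par X \<I> S. (\<Sum>x\<in>C. \<omega> x) = s)
     \<and> real (card (Par X \<I> S)) = c / (c - 1)"
proof (intro exI[of _ "(c - 1) / \<theta>"] conjI ballI impI)
  show "(c - 1) / \<theta> > 0" using c_gt_1 \<theta>_pos by simp
  fix S assume "S \<in> \<I>" "card S = m"
  then obtain U where U: "S \<subseteq> U" "U \<in> bas (m + 2)"
    using bas_extend[OF all_indep_bases, of S "m + 2"] rank by auto
  note loc = extremal_local[OF U(2,1) \<open>card S = m\<close>]
  show "\<gamma> S = R" "real (card (Par X \<I> S)) = c / (c - 1)" by (rule loc)+
  show "(\<Sum>x\<in>C. \<omega> x) = (c - 1) / \<theta>" if "C \<in> Par X \<I> S" for C by (rule loc(2)[OF that])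
qed

end

subsection \<open>Uniform parallel classes\<close>

context matroid
begin

lemma finite_indep_of_size: "finite (indep_of_size \<I> j)"
  unfolding indep_of_size_def using finite_indep_sets by simp

text \<open>Pairs of a set and a continuing element correspond to pairs of the larger set and a
  marked element of it.\<close>

lemma sum_indep_flags:
  "(\<Sum>S\<in>indep_of_size \<I> j. \<Sum>x\<in>Cont X \<I> S. G S x)
    = (\<Sum>U\<in>indep_of_size \<I> (Suc j). \<Sum>x\<in>U. G (U - {x}) x)"
proof -
  have fin: "finite U" if "U \<in> indep_of_size \<I> i" for U i
    using that finite_indep by (simp add: indep_of_size_def)
  have "(\<Sum>S\<in>indep_of_size \<I> j. \<Sum>x\<in>Cont X \<I> S. G S x)
      = (\<Sum>(S, x)\<in>(SIGMA S:indep_of_size \<I> j. Cont X \<I> S). G S x)"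
    by (rule sum.Sigma) (simp_all add: finite_indep_of_size finite_Cont)
  also have "\<dots> = (\<Sum>(U, x)\<in>(SIGMA U:indep_of_size \<I> (Suc j). U). G (U - {x}) x)"
  proof (rule sum.reindex_bij_witness[of _ "\<lambda>(U, x). (U - {x}, x)" "\<lambda>(S, x). (insert x S, x)"], goal_cases)
    case (1 a)
    then show ?case by (auto simp: Cont_iff)
  next
    case (2 a)
    then obtain S x where "a = (S, x)" "S \<in> \<I>" "card S = j" "x \<notin> S" "insert x S \<in> \<I>"
      by (auto simp: indep_of_size_def Cont_iff)
    then show ?case using finite_indep[of S] by (simp add: indep_of_size_def)
  next
    case (3 b)
    then show ?case by (auto simp: insert_absorb)
  next
    case (4 b)
    then obtain U x where U: "b = (U, x)" "U \<in> \<I>" "card U = Suc j" "x \<in> U"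
      by (auto simp: indep_of_size_def)
    moreover have "U - {x} \<in> \<I>" by (rule indep_mono[OF U(2)]) blast
    ultimately show ?case by (simp add: indep_of_size_def Cont_iff insert_absorb)
  next
    case (5 a)
    then show ?case by (auto simp: Cont_iff)
  qed
  also have "\<dots> = (\<Sum>U\<in>indep_of_size \<I> (Suc j). \<Sum>x\<in>U. G (U - {x}) x)"
    by (rule sum.Sigma[symmetric]) (simp_all add: finite_indep_of_size fin)
  finally show ?thesis .
qed

text \<open>Each \<open>U\<close> carries its full weight once per marked element. The factor
  \<open>h\<close> allows this count to be nested.\<close>

lemma prod_mult_sum_Cont:
  fixes \<omega> :: "'a \<Rightarrow> real"
  shows "(\<Sum>S\<in>indep_of_size \<I> j. (\<Prod>x\<in>S. \<omega> x) * (\<Sum>x\<in>Cont X \<I> S. \<omega> x * h (insert x S)))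
    = real (Suc j) * (\<Sum>U\<in>indep_of_size \<I> (Suc j). (\<Prod>x\<in>U. \<omega> x) * h U)"
proof -
  have "(\<Sum>S\<in>indep_of_size \<I> j. (\<Prod>x\<in>S. \<omega> x) * (\<Sum>x\<in>Cont X \<I> S. \<omega> x * h (insert x S)))
      = (\<Sum>U\<in>indep_of_size \<I> (Suc j). \<Sum>x\<in>U. (\<Prod>y\<in>U - {x}. \<omega> y) * (\<omega> x * h (insert x (U - {x}))))"
    unfolding sum_distrib_left by (rule sum_indep_flags)
  also have "\<dots> = (\<Sum>U\<in>indep_of_size \<I> (Suc j). real (Suc j) * ((\<Prod>x\<in>U. \<omega> x) * h U))"
  proof (rule sum.cong[OF refl])
    fix U assume U: "U \<in> indep_of_size \<I> (Suc j)"
    then have fin: "finite U" and card: "card U = Suc j"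
      using finite_indep by (auto simp: indep_of_size_def)
    have "(\<Sum>x\<in>U. (\<Prod>y\<in>U - {x}. \<omega> y) * (\<omega> x * h (insert x (U - {x}))))
        = (\<Sum>x\<in>U. (\<Prod>x\<in>U. \<omega> x) * h U)"
      by (intro sum.cong refl) (simp add: prod.remove[OF fin] insert_absorb)
    then show "(\<Sum>x\<in>U. (\<Prod>y\<in>U - {x}. \<omega> y) * (\<omega> x * h (insert x (U - {x}))))
        = real (Suc j) * ((\<Prod>x\<in>U. \<omega> x) * h U)"
      by (simp add: card)
  qed
  finally show ?thesis by (simp only: sum_distrib_left)
qed

lemma sum_Cont_eq_classes:
  fixes \<omega> :: "'a \<Rightarrow> real"
  assumes "\<And>C. C \<in> Par X \<I> S \<Longrightarrow> (\<Sum>x\<in>C. \<omega> x) = s"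
  shows "(\<Sum>x\<in>Cont X \<I> S. \<omega> x) = real (card (Par X \<I> S)) * s"
  using sum_quotient[OF finite_Cont[of S] equiv_parallel_rel[of S], of \<omega>] assms by (simp add: Par_def)

lemma Cont_insert:
  assumes "x \<in> Cont X \<I> S"
  shows "Cont X \<I> (insert x S) = Cont X \<I> S - parallel_rel X \<I> S `` {x}"
proof -
  have "insert y S \<in> \<I>" if "insert y (insert x S) \<in> \<I>" for y
    using that by (rule indep_mono) blast
  then show ?thesis
    using assms by (auto simp: Cont_iff parallel_rel_iff insert_commute)
qed

text \<open>Sets of size \<open>m\<close> have continuing weight \<open>p * s\<close>; adding
  \<open>x\<close> removes exactly its class and leaves \<open>(p - 1) * s\<close>. One count
  relates \<open>B (m + 1)\<close> to \<open>B m\<close>, a nested one relates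
  \<open>B (m + 2)\<close> to \<open>B m\<close>.\<close>

lemma uniform_classes_imp_eq:
  fixes \<omega> :: "'a \<Rightarrow> real"
  defines "B \<equiv> \<lambda>j. \<Sum>S\<in>indep_of_size \<I> j. \<Prod>x\<in>S. \<omega> x"
  assumes p: "p \<ge> 2"
    and card: "\<And>S. S \<in> indep_of_size \<I> m \<Longrightarrow> card (Par X \<I> S) = p"
    and s: "\<And>S C. S \<in> indep_of_size \<I> m \<Longrightarrow> C \<in> Par X \<I> S \<Longrightarrow> (\<Sum>x\<in>C. \<omega> x) = s"
  shows "(B (Suc m))\<^sup>2 = (1 + 1 / real (Suc m)) * (1 + 1 / (real p - 1)) * B m * B (m + 2)"
proof -
  have Cont: "(\<Sum>x\<in>Cont X \<I> S. \<omega> x) = real p * s" if "S \<in> indep_of_size \<I> m" for S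
    using sum_Cont_eq_classes[of S \<omega> s] s card that by simp
  have Cont_ins: "(\<Sum>y\<in>Cont X \<I> (insert x S). \<omega> y) = (real p - 1) * s"
    if S: "S \<in> indep_of_size \<I> m" and x: "x \<in> Cont X \<I> S" for S x
  proof -
    let ?C = "parallel_rel X \<I> S `` {x}"
    have C: "?C \<in> Par X \<I> S" unfolding Par_def using x by (rule quotientI)
    have "?C \<subseteq> Cont X \<I> S" by (auto simp: parallel_rel_iff)
    then show ?thesis
      unfolding Cont_insert[OF x] using Cont[OF S] s[OF S C] finite_Cont
      by (simp add: sum_diff algebra_simps)
  qed
  have B1: "real (Suc m) * B (Suc m) = real p * s * B m"
    using prod_mult_sum_Cont[of \<omega> "\<lambda>_. 1" m] Cont
    by (simp add: B_def sum_distrib_left mult.commute)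
  have "real (Suc (Suc m)) * B (Suc (Suc m))
      = (\<Sum>U\<in>indep_of_size \<I> (Suc m). (\<Prod>x\<in>U. \<omega> x) * (\<Sum>x\<in>Cont X \<I> U. \<omega> x))"
    using prod_mult_sum_Cont[of \<omega> "\<lambda>_. 1" "Suc m"] by (simp add: B_def)
  \<comment> \<open>The nested count: \<open>h U\<close> is the continuing weight of
    \<open>U\<close>.\<close>
  then have "real (Suc m) * (real (Suc (Suc m)) * B (Suc (Suc m)))
      = (\<Sum>S\<in>indep_of_size \<I> m. (\<Prod>x\<in>S. \<omega> x)
          * (\<Sum>x\<in>Cont X \<I> S. \<omega> x * (\<Sum>y\<in>Cont X \<I> (insert x S). \<omega> y)))"
    using prod_mult_sum_Cont[of \<omega> "\<lambda>U. \<Sum>x\<in>Cont X \<I> U. \<omega> x" m] by (simp only:)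
  also have "\<dots> = (\<Sum>S\<in>indep_of_size \<I> m. (\<Prod>x\<in>S. \<omega> x) * (real p * s * ((real p - 1) * s)))"
  proof (rule sum.cong[OF refl])
    fix S assume S: "S \<in> indep_of_size \<I> m"
    have "(\<Sum>x\<in>Cont X \<I> S. \<omega> x * (\<Sum>y\<in>Cont X \<I> (insert x S). \<omega> y))
        = (\<Sum>x\<in>Cont X \<I> S. \<omega> x * ((real p - 1) * s))"
      by (intro sum.cong refl) (simp add: Cont_ins[OF S])
    also have "\<dots> = real p * s * ((real p - 1) * s)"
      unfolding sum_distrib_right[symmetric] Cont[OF S] ..
    finally show "(\<Prod>x\<in>S. \<omega> x) * (\<Sum>x\<in>Cont X \<I> S. \<omega> x * (\<Sum>y\<in>Cont X \<I> (insert x S). \<omega> y))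
        = (\<Prod>x\<in>S. \<omega> x) * (real p * s * ((real p - 1) * s))" by simp
  qed
  also have "\<dots> = real p * s * ((real p - 1) * s) * B m"
    by (simp add: B_def sum_distrib_right[symmetric])
  finally have B2: "real (Suc m) * (real (Suc (Suc m)) * B (m + 2)) = real p * s * ((real p - 1) * s) * B m"
    by simp
  define k q where "k = real (Suc m)" and "q = real p - 1"
  have k: "k > 0" and q: "q > 0" using p by (auto simp: k_def q_def)
  have e1: "B (Suc m) = (q + 1) * s * B m / k"
    using B1 k by (simp add: k_def q_def field_simps)
  have e2: "B (m + 2) = (q + 1) * s * (q * s) * B m / (k * (k + 1))"
  proof -
    have "k * (k + 1) * B (m + 2) = (q + 1) * s * (q * s) * B m"
      using B2 by (simp add: k_def q_def mult.assoc add.commute)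
    then show ?thesis using k by (simp add: eq_divide_eq mult.commute)
  qed
  have "(B (Suc m))\<^sup>2 = (1 + 1 / k) * (1 + 1 / q) * B m * B (m + 2)"
  proof -
    define l r where "l = k + 1" and "r = q + 1"
    have "l > 0" "1 + 1 / k = l / k" "1 + 1 / q = r / q"
      using k q by (auto simp: l_def r_def field_simps)
    then show ?thesis
      unfolding e1 e2 l_def[symmetric] r_def[symmetric] using k q
      by (simp add: field_simps power2_eq_square)
  qed
  then show ?thesis by (simp only: k_def q_def)
qed

end

section \<open>Specialisation to the pullback of the target rank\<close>

theorem theorem1p19:
  fixes X :: "'a set" and \<I> :: "'a set set"
    and Y :: "'b set" and \<J> :: "'b set set"
    and \<Phi> :: "'a \<Rightarrow> 'b" and \<omega> :: "'a \<Rightarrow> real" and k :: nat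
  assumes "matroid X \<I>" and "matroid Y \<J>"
    and "matroid_morphism X \<I> Y \<J> \<Phi>"
    and "\<And>x. x \<in> X \<Longrightarrow> \<omega> x > 0"
    and "1 \<le> k" and "k < matroid_rank \<I> X"
    and "weighted_bases \<I> Y \<J> \<Phi> \<omega> k > 0"
  shows "(weighted_bases \<I> Y \<J> \<Phi> \<omega> k)\<^sup>2 =
           (1 + 1 / real k) * (1 + 1 / (real (max_par X \<I> Y \<J> \<Phi> (k - 1)) - 1)) *
           weighted_bases \<I> Y \<J> \<Phi> \<omega> (k - 1) * weighted_bases \<I> Y \<J> \<Phi> \<omega> (k + 1)
         \<longleftrightarrow>
         (\<exists>s::real. s > 0 \<and>
           (\<forall>S\<in>indep_of_size \<I> (k - 1).
              card (Par X \<I> S) = max_par X \<I> Y \<J> \<Phi> (k - 1) \<and>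
              (\<forall>C\<in>Par X \<I> S. (\<Sum>x\<in>C. \<omega> x) = s) \<and>
              matroid_rank \<J> (\<Phi> ` S) = matroid_rank \<J> Y))"
proof -
  interpret M: matroid X \<I> by (rule assms(1))
  interpret N: matroid Y \<J> by (rule assms(2))
  define m where "m = k - 1"
  have k: "k = Suc m" "k - 1 = m" "k + 1 = m + 2" using assms(5) by (auto simp: m_def)
  have rank: "m + 2 \<le> matroid_rank \<I> X" using assms(6) k by simp
  define \<gamma> where "\<gamma> S = matroid_rank \<J> (\<Phi> ` S)" for S
  define R where "R = matroid_rank \<J> Y"
  define Bs where "Bs = morphism_bases \<I> Y \<J> \<Phi>"
  define B where "B = weighted_bases \<I> Y \<J> \<Phi> \<omega>"
  define p where "p = max_par X \<I> Y \<J> \<Phi> m"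
  have Bs: "Bs j = {U \<in> \<I>. card U = j \<and> \<gamma> U = R}" for j
    by (auto simp: Bs_def morphism_bases_def indep_of_size_def \<gamma>_def R_def)
  have B: "B j = (\<Sum>S\<in>Bs j. \<Prod>x\<in>S. \<omega> x)" for j
    by (simp add: B_def weighted_bases_def Bs_def)
  have Bk: "B (Suc m) > 0" using assms(7) by (simp add: B_def k)
  \<comment> \<open>A single basis of size \<open>k\<close> forces the image of the ground set to
    have full rank.\<close>
  have "\<gamma> X = R"
  proof -
    have "Bs (Suc m) \<noteq> {}" using Bk by (auto simp: B)
    then obtain S where S: "S \<in> \<I>" "\<gamma> S = R" by (auto simp: Bs)
    have "\<gamma> S \<le> \<gamma> X"
      unfolding \<gamma>_def using M.indep_subset_ground[OF S(1)] by (intro N.rank_mono image_mono)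
    moreover have "\<gamma> X \<le> R"
      unfolding \<gamma>_def R_def using assms(3) by (intro N.rank_mono) (simp add: matroid_morphism_def)
    ultimately show ?thesis using S(2) by simp
  qed
  then have quot: "matroid_quotient X \<I> \<gamma> R"
    using matroid_quotient_morphism[OF assms(3)] unfolding \<gamma>_def[abs_def] R_def by simp
  \<comment> \<open>This prevents the universal statement on the right from being vacuous.\<close>
  obtain S0 where S0: "S0 \<in> indep_of_size \<I> m"
  proof -
    obtain S where "S \<in> \<I>" "card S = m"
      by (rule M.indep_extend[OF M.indep_empty empty_subsetI, of m X]) (use rank in auto)
    then show ?thesis using that by (simp add: indep_of_size_def)
  qed
  have "(B (Suc m))\<^sup>2 = (1 + 1 / real (Suc m)) * (1 + 1 / (real p - 1)) * B m * B (m + 2) \<longleftrightarrow>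
    (\<exists>s>0. \<forall>S\<in>indep_of_size \<I> m. card (Par X \<I> S) = p \<and> (\<forall>C\<in>Par X \<I> S. (\<Sum>x\<in>C. \<omega> x) = s) \<and> \<gamma> S = R)"
    (is "?eq \<longleftrightarrow> ?uniform")
  proof (cases "Bs m = {}")
    \<comment> \<open>Without bases of size \<open>k - 1\<close> the left equation equates a
      positive number with 0, and condition (3) fails at \<open>S0\<close>.\<close>
    case True
    then have "\<not> ?eq" using Bk B[of m] by simp
    moreover have "\<not> ?uniform" using S0 True by (fastforce simp: Bs indep_of_size_def)
    ultimately show ?thesis by blast
  next
    case False
    have finBs: "finite (Bs m)" unfolding Bs using M.finite_indep_sets by simp
    have p_max: "p = Max ((\<lambda>S. card (Par X \<I> S)) ` Bs m)"
    proof -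
      have "{card (Par X \<I> S) | S. S \<in> Bs m} = (\<lambda>S. card (Par X \<I> S)) ` Bs m" by blast
      then show ?thesis using False by (simp add: p_def max_par_def Bs_def)
    qed
    have le_p: "card (Par X \<I> S) \<le> p" if "S \<in> Bs m" for S
      unfolding p_max using finBs that by simp
    have ge_2: "card (Par X \<I> S) \<ge> 2" if "S \<in> Bs m" for S
      using that rank by (intro M.card_Par_ge_2) (auto simp: Bs)
    have p2: "p \<ge> 2" using False order_trans[OF ge_2 le_p] by blast
    define c where "c = 1 + 1 / (real p - 1)"
    have c1: "c > 1" and c_p: "c / (c - 1) = real p"
      using p2 by (auto simp: c_def field_simps)
    have wq: "weighted_quotient X \<I> \<gamma> R \<omega> c"
      using quot assms(4) c1 by (simp add: weighted_quotient_def weighted_quotient_axioms_def)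
    interpret W: weighted_quotient X \<I> \<gamma> R \<omega> c by (rule wq)
    have W_bas: "W.bas = Bs" by (intro ext) (simp add: W.bas_def Bs)
    have W_wsum: "W.wsum = B" by (intro ext) (simp add: W.wsum_def B W_bas)
    show ?thesis
    proof
      assume eq: ?eq
      interpret E: extremal_quotient X \<I> \<gamma> R \<omega> c m
      proof
        fix S assume "S \<in> W.bas m"
        then have "card (Par X \<I> S) \<le> p" "card (Par X \<I> S) \<ge> 2"
          using le_p ge_2 by (simp_all add: W_bas)
        \<comment> \<open>Equality holds when the number of classes is \<open>p\<close>, and the
          left side increases with that number.\<close>
        then show "c * (1 - 1 / real (card (Par X \<I> S))) \<le> 1"
          using p2 by (simp add: c_def field_simps)
      next
        show "(W.wsum (Suc m))\<^sup>2 = (1 + 1 / real (Suc m)) * c * W.wsum m * W.wsum (m + 2)"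
          using eq unfolding W_wsum c_def .
      qed (use rank c1 Bk eq in \<open>simp_all add: W_wsum c_def\<close>)
      obtain s where "s > 0" and s: "\<forall>S\<in>\<I>. card S = m \<longrightarrow> \<gamma> S = R \<and> (\<forall>C\<in>Par X \<I> S. (\<Sum>x\<in>C. \<omega> x) = s)
          \<and> real (card (Par X \<I> S)) = c / (c - 1)"
        using E.extremal_imp_uniform by blast
      then show ?uniform
        unfolding c_p by (intro exI[of _ s]) (auto simp: indep_of_size_def)
    next
      assume ?uniform
      then obtain s where s: "\<forall>S\<in>indep_of_size \<I> m. card (Par X \<I> S) = p
          \<and> (\<forall>C\<in>Par X \<I> S. (\<Sum>x\<in>C. \<omega> x) = s) \<and> \<gamma> S = R"
        by blast
      \<comment> \<open>An independent set of size at least \<open>m\<close> contains one of size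
        \<open>m\<close>, which is a basis by (3); monotonicity of \<gamma> does the rest.\<close>
      have Bs_eq: "Bs j = indep_of_size \<I> j" if "m \<le> j" for j
      proof -
        have "\<gamma> U = R" if U: "U \<in> \<I>" "card U = j" for U
        proof -
          obtain S where S: "S \<subseteq> U" "card S = m" "finite S"
            using obtain_subset_with_card_n[of m U] \<open>m \<le> j\<close> U by auto
          then have "\<gamma> S = R" using s M.indep_mono[OF U(1) S(1)] by (simp add: indep_of_size_def)
          moreover have "U \<subseteq> X" by (rule M.indep_subset_ground[OF U(1)])
          ultimately show ?thesis
            using W.quot_mono[OF S(1)] W.quot_le_top[of U] by simp
        qed
        then show ?thesis by (auto simp: Bs indep_of_size_def)
      qed
      show ?eq
      proof -
        have "Bs m = indep_of_size \<I> m" "Bs (Suc m) = indep_of_size \<I> (Suc m)"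
          "Bs (m + 2) = indep_of_size \<I> (m + 2)"
          by (rule Bs_eq, simp)+
        then show ?thesis
          unfolding B using M.uniform_classes_imp_eq[OF p2, of m \<omega> s] s by simp
      qed
    qed
  qed
  then show ?thesis
    unfolding B_def p_def \<gamma>_def R_def k by simp
qed

end
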